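(* Let $\Omega\subset\mathbb{R}^d$ ($d=2,3$) be a bounded regular domain, $\nu>0$, and let $\|\cdot\|$ and $(\cdot,\cdot)$ denote the $L^2(\Omega)$ norm and inner product. Let time-steps $k_n>0$ and artificial compression parameters $\varepsilon_n>0$ be arbitrary positive numbers, let forcing terms $f_{n}\in H^{-1}(\Omega)^d$ be given, and let initial data $u_0$ (and, for the extrapolation at the first step, $u_{-1}$), $p_0$ be given. Suppose $u_{n}\in H^1_0(\Omega)^d$ (so $u_n=0$ on $\partial\Omega$) and $p_n\in L^2(\Omega)$, $n\ge 1$, satisfy the min-Method: for each $n\ge 0$, with $u^{\ast}=\left(1+\frac{k_{n+1}}{k_n}\right)u_n-\frac{k_{n+1}}{k_n}u_{n-1}$, $$\frac{u_{n+1}-u_{n}}{k_{n+1}}+u^{\ast}\cdot\nabla u_{n+1}+\tfrac{1}{2}(\nabla\cdot u^{\ast})u_{n+1}+\nabla p_{n+1}-\nu\Delta u_{n+1}=f_{n+1},$$ $$\frac{\varepsilon_{n+1}p_{n+1}-\min\{\varepsilon_{n+1},\varepsilon_n\}p_{n}}{k_{n+1}}+\nabla\cdot u_{n+1}=0,$$ the equations being understood in the standard variational (weak) sense. Then the method is unconditionally, long-time stable: for any $N>0$ the energy equality \begin{gather*} \frac{1}{2}\int_{\Omega}|u_{N}|^{2}+\varepsilon_{N}|p_{N}|^{2}\,dx+\sum_{n=0}^{N-1}\frac{1}{2}\int_{\Omega}\Big[\min\{\varepsilon_{n+1},\varepsilon_{n}\}(p_{n+1}-p_{n})^{2}+(\varepsilon_{n+1}-\varepsilon_{n})^{+}p_{n+1}^{2}+(\varepsilon_{n}-\varepsilon_{n+1})^{+}p_{n}^{2}\Big]dx\\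 +\sum_{n=0}^{N-1}\int_{\Omega}\frac{1}{2}|u_{n+1}-u_{n}|^{2}+k_{n+1}\nu|\nabla u_{n+1}|^{2}\,dx =\frac{1}{2}\int_{\Omega}|u_{0}|^{2}+\varepsilon_{0}p_{0}^{2}\,dx+\sum_{n=0}^{N-1}k_{n+1}\int_{\Omega}u_{n+1}\cdot f_{n+1}\,dx \end{gather*} holds, and consequently the stability bound \begin{gather*} \frac{1}{2}\int_{\Omega}|u_{N}|^{2}+\varepsilon_{N}p_{N}^{2}\,dx+\sum_{n=0}^{N-1}\frac{1}{2}\int_{\Omega}\Big[\min\{\varepsilon_{n+1},\varepsilon_{n}\}(p_{n+1}-p_{n})^{2}+(\varepsilon_{n+1}-\varepsilon_{n})^{+}p_{n+1}^{2}+(\varepsilon_{n}-\varepsilon_{n+1})^{+}p_{n}^{2}\Big]dx\\ +\sum_{n=0}^{N-1}\frac{1}{2}\int_{\Omega}|u_{n+1}-u_{n}|^{2}+k_{n+1}\nu|\nabla u_{n+1}|^{2}\,dx \le\frac{1}{2}\int_{\Omega}|u_{0}|^{2}+\varepsilon_{0}p_{0}^{2}\,dx+\sum_{n=0}^{N-1}k_{n+1}\frac{1}{2\nu}\|f_{n+1}\|_{-1}^{2} \end{gather*} holds.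
   Context: For a real number $a$, $a^{+}=\max\{0,a\}$. $\|\cdot\|_{-1}$ denotes the norm of the dual space $H^{-1}(\Omega)$ of $H^1_0(\Omega)$ (equipped with the norm $\|\nabla\cdot\|$). The nonlinear term is in the skew-symmetrized form $u^{\ast}\cdot\nabla u_{n+1}+\frac12(\nabla\cdot u^{\ast})u_{n+1}$. No restriction is placed on the sequences $k_n$, $\varepsilon_n$ other than positivity. *)

theory Defs
  imports "HOL-Analysis.Analysis"
begin

definition lipschitz_domain :: "'a::euclidean_space set \<Rightarrow> bool" where
  "lipschitz_domain \<Omega> \<longleftrightarrow> open \<Omega> \<and> connected \<Omega> \<and> \<Omega> \<noteq> {} \<and> bounded \<Omega> \<and>
     (\<forall>x0\<in>frontier \<Omega>. \<exists>r>0. \<exists>e::'a. \<exists>g::'a \<Rightarrow> real. \<exists>L.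
        norm e = 1 \<and> L-lipschitz_on {y. y \<bullet> e = 0} g \<and>
        \<Omega> \<inter> ball x0 r = {y \<in> ball x0 r. y \<bullet> e < g (y - (y \<bullet> e) *\<^sub>R e)})"

fun Ck :: "nat \<Rightarrow> ('a::euclidean_space \<Rightarrow> real) \<Rightarrow> bool" where
  "Ck 0 f = continuous_on UNIV f"
| "Ck (Suc m) f = (f differentiable_on UNIV \<and>
      (\<forall>i\<in>Basis. Ck m (\<lambda>x. frechet_derivative f (at x) i)))"

definition smooth_fun :: "('a::euclidean_space \<Rightarrow> real) \<Rightarrow> bool" where
  "smooth_fun f \<longleftrightarrow> (\<forall>m. Ck m f)"

definition test_fun :: "'a::euclidean_space set \<Rightarrow> ('a \<Rightarrow> real) \<Rightarrow> bool" where
  "test_fun \<Omega> \<phi> \<longleftrightarrow> smooth_fun \<phi> \<and> compact (closure {x. \<phi> x \<noteq> 0}) \<and>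
     closure {x. \<phi> x \<noteq> 0} \<subseteq> \<Omega>"

definition test_vfun :: "'a::euclidean_space set \<Rightarrow> ('a \<Rightarrow> 'a) \<Rightarrow> bool" where
  "test_vfun \<Omega> \<phi> \<longleftrightarrow> (\<forall>j\<in>Basis. test_fun \<Omega> (\<lambda>x. \<phi> x \<bullet> j))"

definition L2 :: "'a::euclidean_space set \<Rightarrow> ('a \<Rightarrow> real) \<Rightarrow> bool" where
  "L2 \<Omega> f \<longleftrightarrow> f \<in> borel_measurable (lebesgue_on \<Omega>) \<and>
     integrable (lebesgue_on \<Omega>) (\<lambda>x. (f x)\<^sup>2)"

definition L2v :: "'a::euclidean_space set \<Rightarrow> ('a \<Rightarrow> 'a) \<Rightarrow> bool" where
  "L2v \<Omega> u \<longleftrightarrow> u \<in> borel_measurable (lebesgue_on \<Omega>) \<and>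
     integrable (lebesgue_on \<Omega>) (\<lambda>x. (norm (u x))\<^sup>2)"

text \<open>A gradient field Du of a vector field u is represented by Du x i = \<partial>_i u (x)
  for basis vectors i.  Du is a weak gradient of u on \<Omega> if for every component j
  and direction i, and every test function \<phi>,
  \<integral>_\<Omega> u_j \<partial>_i\<phi> = - \<integral>_\<Omega> (\<partial>_i u)_j \<phi>.\<close>
definition weak_grad :: "'a::euclidean_space set \<Rightarrow> ('a \<Rightarrow> 'a) \<Rightarrow> ('a \<Rightarrow> 'a \<Rightarrow> 'a) \<Rightarrow> bool" where
  "weak_grad \<Omega> u Du \<longleftrightarrow> (\<forall>i\<in>Basis. \<forall>j\<in>Basis. \<forall>\<phi>. test_fun \<Omega> \<phi> \<longrightarrow>
      (LINT x|lebesgue_on \<Omega>. (u x \<bullet> j) * frechet_derivative \<phi> (at x) i)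
      = - (LINT x|lebesgue_on \<Omega>. (Du x i \<bullet> j) * \<phi> x))"

definition H1 :: "'a::euclidean_space set \<Rightarrow> ('a \<Rightarrow> 'a) \<Rightarrow> ('a \<Rightarrow> 'a \<Rightarrow> 'a) \<Rightarrow> bool" where
  "H1 \<Omega> u Du \<longleftrightarrow> L2v \<Omega> u \<and> (\<forall>i\<in>Basis. L2v \<Omega> (\<lambda>x. Du x i)) \<and> weak_grad \<Omega> u Du"

definition H10 :: "'a::euclidean_space set \<Rightarrow> ('a \<Rightarrow> 'a) \<Rightarrow> ('a \<Rightarrow> 'a \<Rightarrow> 'a) \<Rightarrow> bool" where
  "H10 \<Omega> u Du \<longleftrightarrow> H1 \<Omega> u Du \<and>
     (\<exists>\<phi>::nat \<Rightarrow> 'a \<Rightarrow> 'a. (\<forall>m. test_vfun \<Omega> (\<phi> m)) \<and>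
        (\<lambda>m. LINT x|lebesgue_on \<Omega>. (norm (\<phi> m x - u x))\<^sup>2) \<longlonglongrightarrow> 0 \<and>
        (\<lambda>m. LINT x|lebesgue_on \<Omega>.
            (\<Sum>i\<in>Basis. (norm (frechet_derivative (\<phi> m) (at x) i - Du x i))\<^sup>2)) \<longlonglongrightarrow> 0)"

definition grad_sq :: "('a::euclidean_space \<Rightarrow> 'a \<Rightarrow> 'a) \<Rightarrow> 'a \<Rightarrow> real" where
  "grad_sq Du x = (\<Sum>i\<in>Basis. (norm (Du x i))\<^sup>2)"

definition grad_inner :: "('a::euclidean_space \<Rightarrow> 'a \<Rightarrow> 'a) \<Rightarrow> ('a \<Rightarrow> 'a \<Rightarrow> 'a) \<Rightarrow> 'a \<Rightarrow> real" where
  "grad_inner Du Dv x = (\<Sum>i\<in>Basis. Du x i \<bullet> Dv x i)"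

definition divg :: "('a::euclidean_space \<Rightarrow> 'a \<Rightarrow> 'a) \<Rightarrow> 'a \<Rightarrow> real" where
  "divg Du x = (\<Sum>i\<in>Basis. Du x i \<bullet> i)"

definition convect :: "('a::euclidean_space \<Rightarrow> 'a) \<Rightarrow> ('a \<Rightarrow> 'a \<Rightarrow> 'a) \<Rightarrow> 'a \<Rightarrow> 'a" where
  "convect w Du x = (\<Sum>i\<in>Basis. (w x \<bullet> i) *\<^sub>R Du x i)"

definition grad_norm :: "'a::euclidean_space set \<Rightarrow> ('a \<Rightarrow> 'a \<Rightarrow> 'a) \<Rightarrow> real" where
  "grad_norm \<Omega> Dv = sqrt (LINT x|lebesgue_on \<Omega>. grad_sq Dv x)"

text \<open>An element of H^{-1}(\<Omega>)^d is represented by the functional v \<mapsto> <f, v> on H^1_0(\<Omega>)^d: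
  linear and bounded w.r.t. \<parallel>\<nabla>\<cdot>\<parallel>.\<close>
definition Hm1 :: "'a::euclidean_space set \<Rightarrow> (('a \<Rightarrow> 'a) \<Rightarrow> real) \<Rightarrow> bool" where
  "Hm1 \<Omega> F \<longleftrightarrow>
     (\<forall>v Dv w Dw (a::real) (b::real). H10 \<Omega> v Dv \<longrightarrow> H10 \<Omega> w Dw \<longrightarrow>
        F (\<lambda>x. a *\<^sub>R v x + b *\<^sub>R w x) = a * F v + b * F w) \<and>
     (\<exists>C. \<forall>v Dv. H10 \<Omega> v Dv \<longrightarrow> \<bar>F v\<bar> \<le> C * grad_norm \<Omega> Dv)"

text \<open>Dual norm \<parallel>f\<parallel>_{-1} = sup over v \<in> H^1_0, v \<noteq> 0, of |<f,v>| / \<parallel>\<nabla>v\<parallel>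
  (for \<parallel>\<nabla>v\<parallel> = 0 the quotient is 0 by the HOL convention x/0 = 0, which does not change the sup).\<close>
definition dual_norm :: "'a::euclidean_space set \<Rightarrow> (('a \<Rightarrow> 'a) \<Rightarrow> real) \<Rightarrow> real" where
  "dual_norm \<Omega> F = Sup {\<bar>F v\<bar> / grad_norm \<Omega> Dv | v Dv. H10 \<Omega> v Dv}"

definition prev :: "'b \<Rightarrow> (nat \<Rightarrow> 'b) \<Rightarrow> nat \<Rightarrow> 'b" where
  "prev um1 u n = (if n = 0 then um1 else u (n - 1))"

definition pos_part :: "real \<Rightarrow> real" where
  "pos_part a = max 0 a"

end

theory Submission
  imports Defs
begin

text \<open>
  Formally the energy equality comes from testing the momentum equation with \<open>u\<^sub>n\<^sub>+\<^sub>1\<close> itself, but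
  for \<open>u\<^sup>*\<close> merely in \<open>H\<^sup>1\<close> the convection term is then integrable only thanks to an embedding
  of \<open>H\<^sup>1(\<Omega>)\<close> into \<open>L\<^sup>4(\<Omega>)\<close>.  This embedding is avoided by testing with the bounded fields whose
  components are \<open>T\<^sub>\<delta>(u\<^sub>j) = sin(\<delta> u\<^sub>j)/\<delta>\<close>.  With the primitive
  \<open>S\<^sub>\<delta>(s) = (1 - cos(\<delta> s))/\<delta>\<^sup>2\<close> of \<open>T\<^sub>\<delta>\<close>, integration by parts turns
  \<open>\<integral> u\<^sup>* \<cdot> \<nabla>u\<^sub>j T\<^sub>\<delta>(u\<^sub>j)\<close> into \<open>- \<integral> (\<nabla> \<cdot> u\<^sup>*) S\<^sub>\<delta>(u\<^sub>j)\<close>, so that the skew-symmetrized term equals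
  \<open>\<Sum>\<^sub>j \<integral> (\<nabla> \<cdot> u\<^sup>*) (u\<^sub>j T\<^sub>\<delta>(u\<^sub>j)/2 - S\<^sub>\<delta>(u\<^sub>j))\<close>.  The integrand is dominated by
  \<open>|\<nabla> \<cdot> u\<^sup>*| u\<^sub>j\<^sup>2\<close>, which is integrable because \<open>H\<^sup>1\<^sub>0\<close> embeds into \<open>L\<^sup>4\<close> in dimensions 2 and 3
  (Ladyzhenskaya's inequality), and it tends to 0 with \<open>\<delta>\<close>.  The functional on the right-hand side
  passes to the limit since it is bounded in the gradient norm.  What remains is the polarization
  identity for the velocity, the corresponding identity with weights for the pressure, and
  a telescoping sum; the stability bound follows by Young's inequality.
\<close>

section \<open>Smooth functions and test functions\<close>

lemma Ck_imp_continuous: "Ck m f \<Longrightarrow> continuous_on UNIV f"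
  by (cases m) (auto intro: differentiable_imp_continuous_on)

lemma Ck_Suc_partial:
  "Ck (Suc m) f \<Longrightarrow> i \<in> Basis \<Longrightarrow> Ck m (\<lambda>x. frechet_derivative f (at x) i)"
  by simp

lemma Ck_Suc_differentiable: "Ck (Suc m) f \<Longrightarrow> f differentiable (at x)"
  by (simp add: differentiable_on_def)

lemma Ck_Suc_has_derivative:
  "Ck (Suc m) f \<Longrightarrow> (f has_derivative frechet_derivative f (at x)) (at x)"
  using Ck_Suc_differentiable frechet_derivative_works by blast

text \<open>The derivative of a product or of a composition still contains undifferentiated factors,
  so the inductions below have to lower the order of these factors by one.\<close>

lemma Ck_SucD: "Ck (Suc m) f \<Longrightarrow> Ck m f"
proof (induction m arbitrary: f)
  case 0
  then show ?case by (auto intro: differentiable_imp_continuous_on)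
next
  case (Suc m)
  have "f differentiable_on UNIV" using Suc.prems by simp
  moreover have "Ck m (\<lambda>x. frechet_derivative f (at x) i)" if "i \<in> Basis" for i
    using Suc.IH[OF Ck_Suc_partial[OF Suc.prems that]] .
  ultimately show ?case by simp
qed

text \<open>By uniqueness of the derivative, an explicitly computed \<open>f'\<close> may replace
  the \<open>frechet_derivative\<close> that occurs in the recursion for \<open>Ck\<close>.\<close>

lemma Ck_SucI:
  assumes "\<And>x. (f has_derivative f' x) (at x)" and "\<And>i. i \<in> Basis \<Longrightarrow> Ck m (\<lambda>x. f' x i)"
  shows "Ck (Suc m) f"
proof -
  have "frechet_derivative f (at x) = f' x" for x
    using frechet_derivative_at[OF assms(1)] by simp
  with assms show ?thesis
    by (auto simp: differentiable_on_def differentiable_def)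
qed

declare Ck.simps(2) [simp del]

lemma Ck_const: "Ck m (\<lambda>x. c)"
proof (induction m arbitrary: c)
  case (Suc m)
  show ?case by (rule Ck_SucI[where f' = "\<lambda>_ _. 0"]) (auto intro: Suc)
qed simp

lemma Ck_add: "Ck m f \<Longrightarrow> Ck m g \<Longrightarrow> Ck m (\<lambda>x. f x + g x)"
proof (induction m arbitrary: f g)
  case (Suc m)
  show ?case
    by (rule Ck_SucI[OF has_derivative_add[OF Ck_Suc_has_derivative[OF Suc.prems(1)]
            Ck_Suc_has_derivative[OF Suc.prems(2)]]])
       (intro Suc.IH Ck_Suc_partial Suc.prems)
qed (auto intro: continuous_intros)

lemma Ck_mult: "Ck m f \<Longrightarrow> Ck m g \<Longrightarrow> Ck m (\<lambda>x. f x * g x)"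
proof (induction m arbitrary: f g)
  case (Suc m)
  show ?case
    by (rule Ck_SucI[OF has_derivative_mult[OF Ck_Suc_has_derivative[OF Suc.prems(1)]
            Ck_Suc_has_derivative[OF Suc.prems(2)]]])
       (intro Ck_add Suc.IH Ck_Suc_partial Suc.prems Ck_SucD[OF Suc.prems(1)] Ck_SucD[OF Suc.prems(2)])
qed (auto intro: continuous_intros)

text \<open>The chain rule writes each partial derivative as a partial derivative of
  \<open>f\<close> times \<open>g'\<close> composed with \<open>f\<close>. The derivative of
  \<open>g\<close> takes the place of \<open>g\<close> in the next round, so the induction must
  generalize over both functions.\<close>

lemma Ck_compose:
  fixes g :: "real \<Rightarrow> real"
  shows "Ck m g \<Longrightarrow> Ck m f \<Longrightarrow> Ck m (\<lambda>x. g (f x))"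
proof (induction m arbitrary: g f)
  case 0
  then show ?case
    using continuous_on_compose2[of UNIV g UNIV f] by auto
next
  case (Suc m)
  let ?g' = "\<lambda>y. frechet_derivative g (at y) 1"
  \<comment> \<open>On the real line a linear map is multiplication by its value at 1.\<close>
  have g': "frechet_derivative g (at y) h = h * ?g' y" for y h
    using linear_scale[OF linear_frechet_derivative[OF Ck_Suc_differentiable[OF Suc.prems(1)]], of y h 1]
    by simp
  have D: "((\<lambda>x. g (f x)) has_derivative (\<lambda>h. frechet_derivative f (at x) h * ?g' (f x))) (at x)" for x
    using has_derivative_compose[OF Ck_Suc_has_derivative[OF Suc.prems(2)]
      Ck_Suc_has_derivative[OF Suc.prems(1)], of x] by (subst (asm) g')
  show ?case
    by (rule Ck_SucI[OF D], rule Ck_mult[OF Ck_Suc_partial[OF Suc.prems(2)]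
          Suc.IH[OF Ck_Suc_partial[OF Suc.prems(1)] Ck_SucD[OF Suc.prems(2)]]]) auto
qed

lemma smooth_fun_has_derivative:
  "smooth_fun f \<Longrightarrow> (f has_derivative frechet_derivative f (at x)) (at x)"
  unfolding smooth_fun_def using Ck_Suc_has_derivative by blast

lemma smooth_fun_partial:
  "smooth_fun f \<Longrightarrow> i \<in> Basis \<Longrightarrow> smooth_fun (\<lambda>x. frechet_derivative f (at x) i)"
  unfolding smooth_fun_def using Ck_Suc_partial by blast

lemma smooth_fun_continuous: "smooth_fun f \<Longrightarrow> continuous_on UNIV f"
  unfolding smooth_fun_def using Ck_imp_continuous by blast

lemma smooth_fun_const: "smooth_fun (\<lambda>x. c)"
  by (simp add: smooth_fun_def Ck_const)

lemma smooth_fun_mult: "smooth_fun f \<Longrightarrow> smooth_fun g \<Longrightarrow> smooth_fun (\<lambda>x. f x * g x)"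
  by (simp add: smooth_fun_def Ck_mult)

lemma smooth_fun_add: "smooth_fun f \<Longrightarrow> smooth_fun g \<Longrightarrow> smooth_fun (\<lambda>x. f x + g x)"
  by (simp add: smooth_fun_def Ck_add)

lemma smooth_fun_compose:
  fixes g :: "real \<Rightarrow> real"
  shows "smooth_fun g \<Longrightarrow> smooth_fun f \<Longrightarrow> smooth_fun (\<lambda>x. g (f x))"
  by (simp add: smooth_fun_def Ck_compose)

text \<open>On the real line smoothness passes from a derivative to its primitive. Continuity
  settles order 0, and order \<open>Suc m\<close> is order \<open>m\<close> of
  \<open>g'\<close>.\<close>

lemma smooth_fun_DERIV:
  fixes g :: "real \<Rightarrow> real"
  assumes "\<And>x. (g has_real_derivative g' x) (at x)" "smooth_fun g'"
  shows "smooth_fun g"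
  unfolding smooth_fun_def
proof
  fix m show "Ck m g"
    by (cases m)
       (use assms in \<open>auto intro!: Ck_SucI[OF has_field_derivative_imp_has_derivative[OF assms(1)]]
         simp: smooth_fun_def continuous_on_eq_continuous_at intro: DERIV_isCont\<close>)
qed

lemma smooth_fun_ident: "smooth_fun (\<lambda>x::real. x)"
  by (rule smooth_fun_DERIV[where g' = "\<lambda>_. 1"]) (auto intro!: derivative_eq_intros smooth_fun_const)

text \<open>Differentiation exchanges sine and cosine up to sign, so both are treated in a single
  induction.\<close>

lemma Ck_sin_cos: "Ck m (sin :: real \<Rightarrow> real) \<and> Ck m (cos :: real \<Rightarrow> real)"
proof (induction m)
  case 0
  show ?case by (auto intro: continuous_intros)
next
  case (Suc m)
  have "Ck (Suc m) (sin :: real \<Rightarrow> real)"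
    by (rule Ck_SucI[OF has_field_derivative_imp_has_derivative[OF DERIV_sin]])
       (use Suc in auto)
  moreover have "Ck (Suc m) (cos :: real \<Rightarrow> real)"
    by (rule Ck_SucI[OF has_field_derivative_imp_has_derivative[OF DERIV_cos]])
       (use Suc Ck_mult[OF Ck_const[of m "-1"], of sin] in auto)
  ultimately show ?case ..
qed

lemma smooth_fun_cos: "smooth_fun (\<lambda>x::real. cos (c * x))"
  using smooth_fun_compose[of cos "\<lambda>x. c * x"] Ck_sin_cos
  by (simp add: smooth_fun_def Ck_mult Ck_const smooth_fun_ident[unfolded smooth_fun_def])

section \<open>Closure properties of test functions\<close>

lemma mem_closure_support: "f x \<noteq> 0 \<Longrightarrow> x \<in> closure {x. f x \<noteq> 0}"
  by (rule subsetD[OF closure_subset]) simp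

text \<open>A closed subset of a compact set is compact, so only the location of the nonzero values
  of \<open>g\<close> has to be checked. All closure properties of test functions below reduce to
  this.\<close>

lemma test_fun_subset_support:
  assumes "test_fun \<Omega> f" "smooth_fun g" "{x. g x \<noteq> 0} \<subseteq> closure {x. f x \<noteq> 0}"
  shows "test_fun \<Omega> g"
proof -
  have "closure {x. g x \<noteq> 0} \<subseteq> closure {x. f x \<noteq> 0}"
    using assms(3) by (metis closed_closure closure_minimal)
  moreover from this have "compact (closure {x. g x \<noteq> 0})"
    using assms(1) unfolding test_fun_def compact_eq_bounded_closed
    by (meson bounded_subset closed_closure)
  ultimately show ?thesis
    using assms unfolding test_fun_def by blast
qed

lemma test_fun_compose:
  assumes "test_fun \<Omega> f" "smooth_fun g" "g (0::real) = 0"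
  shows "test_fun \<Omega> (\<lambda>x. g (f x))"
proof (rule test_fun_subset_support[OF assms(1)])
  show "smooth_fun (\<lambda>x. g (f x))"
    using assms by (simp add: test_fun_def smooth_fun_compose)
  show "{x. g (f x) \<noteq> 0} \<subseteq> closure {x. f x \<noteq> 0}"
    using assms(3) by (auto intro!: mem_closure_support)
qed

lemma test_fun_mult:
  assumes "test_fun \<Omega> f" "smooth_fun g"
  shows "test_fun \<Omega> (\<lambda>x. f x * g x)"
  by (rule test_fun_subset_support[OF assms(1)])
     (use assms in \<open>auto simp: test_fun_def intro!: smooth_fun_mult mem_closure_support\<close>)

lemma test_fun_has_derivative:
  "test_fun \<Omega> f \<Longrightarrow> (f has_derivative frechet_derivative f (at x)) (at x)"
  by (simp add: test_fun_def smooth_fun_has_derivative)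

text \<open>Off the support \<open>f\<close> vanishes on an open set, where its derivative is
  therefore zero.\<close>

lemma test_fun_partial:
  assumes f: "test_fun \<Omega> f" and i: "i \<in> Basis"
  shows "test_fun \<Omega> (\<lambda>x. frechet_derivative f (at x) i)"
proof (rule test_fun_subset_support[OF f])
  show "smooth_fun (\<lambda>x. frechet_derivative f (at x) i)"
    using f i by (simp add: test_fun_def smooth_fun_partial)
  show "{x. frechet_derivative f (at x) i \<noteq> 0} \<subseteq> closure {x. f x \<noteq> 0}"
  proof (rule ccontr)
    assume "\<not> ?thesis"
    then obtain x where x: "frechet_derivative f (at x) i \<noteq> 0" "x \<in> - closure {x. f x \<noteq> 0}"
      by auto
    have "(f has_derivative (\<lambda>_. 0)) (at x)"
    proof (rule has_derivative_transform_within_open[of "\<lambda>_. 0"])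
      show "open (- closure {x. f x \<noteq> 0})" by auto
      show "0 = f y" if "y \<in> - closure {x. f x \<noteq> 0}" for y
        using that mem_closure_support[of f y] by auto
    qed (use x in auto)
    then have "frechet_derivative f (at x) = (\<lambda>_. 0)"
      using frechet_derivative_at by metis
    with x show False by simp
  qed
qed

lemma test_fun_continuous: "test_fun \<Omega> f \<Longrightarrow> continuous_on UNIV f"
  by (simp add: test_fun_def smooth_fun_continuous)

lemma test_fun_zero_outside: "test_fun \<Omega> f \<Longrightarrow> x \<notin> \<Omega> \<Longrightarrow> f x = 0"
  unfolding test_fun_def using mem_closure_support[of f x] by auto

section \<open>Measurability, boundedness and integrability of test functions\<close>

lemma test_fun_measurable [measurable]: "test_fun \<Omega> f \<Longrightarrow> f \<in> borel_measurable borel"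
  by (intro borel_measurable_continuous_onI test_fun_continuous)

lemma borel_measurable_lebesgue_on:
  "f \<in> borel_measurable borel \<Longrightarrow> f \<in> borel_measurable (lebesgue_on \<Omega>)"
  by (intro measurable_restrict_space1 measurable_completion) simp

lemma test_fun_bounded:
  assumes f: "test_fun \<Omega> f"
  obtains B where "\<And>x. \<bar>f x\<bar> \<le> B"
proof -
  let ?K = "closure {x. f x \<noteq> 0}"
  have "compact (f ` ?K)"
    using f test_fun_continuous[OF f] continuous_on_subset
    by (intro compact_continuous_image) (auto simp: test_fun_def)
  then obtain B where B: "\<And>y. y \<in> f ` ?K \<Longrightarrow> \<bar>y\<bar> \<le> B"
    using compact_imp_bounded bounded_iff real_norm_def by metis
  have "\<bar>f x\<bar> \<le> max B 0" for x
  proof (cases "f x = 0")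
    case False
    then have "x \<in> ?K" by (rule mem_closure_support)
    with B[of "f x"] show ?thesis by auto
  qed auto
  then show ?thesis using that by blast
qed

lemma test_fun_support_ball:
  assumes f: "test_fun \<Omega> f"
  obtains r where "r > 0" "\<And>x. norm x > r \<Longrightarrow> f x = 0"
proof -
  have "bounded (closure {x. f x \<noteq> 0})"
    using f compact_imp_bounded by (auto simp: test_fun_def)
  then obtain r where "r > 0" "\<And>x. x \<in> closure {x. f x \<noteq> 0} \<Longrightarrow> norm x \<le> r"
    using bounded_pos by blast
  then show ?thesis using that mem_closure_support[of f]
    by (meson linorder_not_le)
qed

lemma test_fun_integrable_lborel:
  assumes f: "test_fun \<Omega> f"
  shows "integrable lborel f"
proof -
  let ?K = "closure {x. f x \<noteq> 0}"
  have "integrable lborel (\<lambda>x. indicator ?K x *\<^sub>R f x)"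
    by (rule borel_integrable_compact)
       (use f test_fun_continuous[OF f] continuous_on_subset in \<open>auto simp: test_fun_def\<close>)
  moreover have "(\<lambda>x. indicator ?K x *\<^sub>R f x) = f"
    using mem_closure_support[of f] by (auto simp: indicator_def fun_eq_iff)
  ultimately show ?thesis by simp
qed

text \<open>This passes from integrals over the domain to integrals over the whole space, where
  translation invariance and iterated integration are available.\<close>

lemma lebesgue_on_eq_lborel:
  fixes f :: "'a::euclidean_space \<Rightarrow> real"
  assumes \<Omega>: "\<Omega> \<in> sets lebesgue" and f: "f \<in> borel_measurable borel" and 0: "\<And>x. x \<notin> \<Omega> \<Longrightarrow> f x = 0"
  shows "integrable (lebesgue_on \<Omega>) f \<longleftrightarrow> integrable lborel f"
    and "integral\<^sup>L (lebesgue_on \<Omega>) f = integral\<^sup>L lborel f"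
proof -
  have *: "(\<lambda>x. indicator \<Omega> x *\<^sub>R f x) = f"
    using 0 by (auto simp: indicator_def fun_eq_iff)
  show "integrable (lebesgue_on \<Omega>) f \<longleftrightarrow> integrable lborel f"
    using \<Omega> f by (subst integrable_restrict_space) (simp_all add: integrable_completion del: real_scaleR_def, simp_all only: * integrable_completion measurable_lborel2)
  show "integral\<^sup>L (lebesgue_on \<Omega>) f = integral\<^sup>L lborel f"
    using \<Omega> f by (subst integral_restrict_space) (simp_all del: real_scaleR_def, simp_all only: * integral_completion measurable_lborel2)
qed

lemma test_fun_integrable:
  "\<Omega> \<in> sets lebesgue \<Longrightarrow> test_fun \<Omega> f \<Longrightarrow> integrable (lebesgue_on \<Omega>) f"
  by (subst lebesgue_on_eq_lborel(1))
     (auto intro: test_fun_integrable_lborel test_fun_measurable test_fun_zero_outside)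

lemma test_fun_L2:
  assumes "\<Omega> \<in> sets lebesgue" "test_fun \<Omega> f"
  shows "L2 \<Omega> f"
  unfolding L2_def power2_eq_square
  using assms test_fun_integrable[OF assms(1) test_fun_mult[OF assms(2), of f]]
  by (auto simp: test_fun_def intro: borel_measurable_lebesgue_on test_fun_measurable)

section \<open>Ladyzhenskaya's inequality\<close>

lemma borel_measurable_PiM_component:
  "i \<in> I \<Longrightarrow> (\<lambda>x. x i :: real) \<in> borel_measurable (\<Pi>\<^sub>M b\<in>I. lborel)"
  using measurable_component_singleton[of i I "\<lambda>_. lborel :: real measure"] by simp

text \<open>Lebesgue measure is the image of the product measure over \<open>Basis\<close>, and this
  product is integrated one coordinate at a time.\<close>

lemma nn_integral_lborel_basis2:
  fixes f :: "'a::euclidean_space \<Rightarrow> ennreal"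
  assumes B: "(Basis::'a set) = {a, b}" "a \<noteq> b" and f[measurable]: "f \<in> borel_measurable borel"
  shows "(\<integral>\<^sup>+x. f x \<partial>lborel) = (\<integral>\<^sup>+s. \<integral>\<^sup>+t. f (s *\<^sub>R a + t *\<^sub>R b) \<partial>lborel \<partial>lborel)"
proof -
  interpret product_sigma_finite "\<lambda>_::'a. lborel :: real measure" by standard
  note comp = borel_measurable_PiM_component
  have m: "(\<lambda>x. x a *\<^sub>R a + x b *\<^sub>R b) \<in> borel_measurable (\<Pi>\<^sub>M b\<in>{b, a}. lborel)"
    by (intro borel_measurable_add borel_measurable_scaleR comp) auto
  \<comment> \<open>The coordinate listed first is peeled off first and becomes the innermost
    integral, hence the reversed order.\<close>
  have B': "(Basis::'a set) = {b, a}" using B(1) by auto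
  have "(\<integral>\<^sup>+x. f x \<partial>lborel) = (\<integral>\<^sup>+x. f (x a *\<^sub>R a + x b *\<^sub>R b) \<partial>(\<Pi>\<^sub>M b\<in>{b, a}. lborel))"
    by (subst lborel_eq, subst nn_integral_distr) (use B(2) m in \<open>simp_all add: B' add_ac\<close>)
  also have "\<dots> = (\<integral>\<^sup>+x. (\<integral>\<^sup>+t. f (x a *\<^sub>R a + t *\<^sub>R b) \<partial>lborel) \<partial>(\<Pi>\<^sub>M b\<in>{a}. lborel))"
    using B(2) measurable_compose[OF m f] by (subst product_nn_integral_insert) simp_all
  also have "\<dots> = (\<integral>\<^sup>+s. \<integral>\<^sup>+t. f (s *\<^sub>R a + t *\<^sub>R b) \<partial>lborel \<partial>lborel)"
    by (rule product_nn_integral_singleton) simp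
  finally show ?thesis .
qed

text \<open>The direction \<open>c\<close> is outermost, so for fixed \<open>r\<close> the two inner
  integrals run over a plane orthogonal to \<open>c\<close>.\<close>

lemma nn_integral_lborel_basis3:
  fixes f :: "'a::euclidean_space \<Rightarrow> ennreal"
  assumes B: "(Basis::'a set) = {a, b, c}" "a \<noteq> b" "a \<noteq> c" "b \<noteq> c"
    and f[measurable]: "f \<in> borel_measurable borel"
  shows "(\<integral>\<^sup>+x. f x \<partial>lborel) =
    (\<integral>\<^sup>+r. \<integral>\<^sup>+s. \<integral>\<^sup>+t. f (r *\<^sub>R c + (s *\<^sub>R a + t *\<^sub>R b)) \<partial>lborel \<partial>lborel \<partial>lborel)"
proof -
  interpret product_sigma_finite "\<lambda>_::'a. lborel :: real measure" by standard
  note comp = borel_measurable_PiM_component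
  have m: "(\<lambda>x. x c *\<^sub>R c + (x a *\<^sub>R a + x b *\<^sub>R b)) \<in> borel_measurable (\<Pi>\<^sub>M b\<in>{b, a, c}. lborel)"
    by (intro borel_measurable_add borel_measurable_scaleR comp) auto
  have B': "(Basis::'a set) = {b, a, c}" using B(1) by auto
  have "(\<integral>\<^sup>+x. f x \<partial>lborel) = (\<integral>\<^sup>+x. f (x c *\<^sub>R c + (x a *\<^sub>R a + x b *\<^sub>R b)) \<partial>(\<Pi>\<^sub>M b\<in>{b, a, c}. lborel))"
    by (subst lborel_eq, subst nn_integral_distr) (use B(2-4) m in \<open>simp_all add: B' add_ac\<close>)
  also have "\<dots> = (\<integral>\<^sup>+x. (\<integral>\<^sup>+t. f (x c *\<^sub>R c + (x a *\<^sub>R a + t *\<^sub>R b)) \<partial>lborel) \<partial>(\<Pi>\<^sub>M b\<in>{a, c}. lborel))"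
    using B(2-4) measurable_compose[OF m f] by (subst product_nn_integral_insert) simp_all
  also have "\<dots> = (\<integral>\<^sup>+x. \<integral>\<^sup>+s. \<integral>\<^sup>+t. f (x c *\<^sub>R c + (s *\<^sub>R a + t *\<^sub>R b)) \<partial>lborel \<partial>lborel \<partial>(\<Pi>\<^sub>M b\<in>{c}. lborel))"
  proof -
    \<comment> \<open>Peeling off the second coordinate requires the inner integral to be measurable
      in the remaining ones. This follows from joint measurability of the integrand.\<close>
    have "(\<lambda>p. fst p c *\<^sub>R c + (fst p a *\<^sub>R a + snd p *\<^sub>R b)) \<in>
        borel_measurable ((\<Pi>\<^sub>M b\<in>{a, c}. lborel) \<Otimes>\<^sub>M lborel)"
      by (intro borel_measurable_add borel_measurable_scaleR measurable_compose[OF measurable_fst comp]) auto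
    from measurable_compose[OF this f]
    have "(\<lambda>x. \<integral>\<^sup>+t. f (x c *\<^sub>R c + (x a *\<^sub>R a + t *\<^sub>R b)) \<partial>lborel) \<in> borel_measurable (\<Pi>\<^sub>M b\<in>{a, c}. lborel)"
      by (intro lborel.borel_measurable_nn_integral) (simp add: case_prod_beta)
    then show ?thesis
      using B(2-4) by (subst product_nn_integral_insert) simp_all
  qed
  also have "\<dots> = (\<integral>\<^sup>+r. \<integral>\<^sup>+s. \<integral>\<^sup>+t. f (r *\<^sub>R c + (s *\<^sub>R a + t *\<^sub>R b)) \<partial>lborel \<partial>lborel \<partial>lborel)"
    by (rule product_nn_integral_singleton) simp
  finally show ?thesis .
qed

text \<open>The first bound for \<open>q\<close> depends on \<open>t\<close> alone and the second on
  \<open>s\<close> alone. Their product dominates the square of \<open>q\<close>, and its double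
  integral factorizes.\<close>

lemma nn_integral_square_le_product:
  fixes q A B :: "real \<Rightarrow> real \<Rightarrow> ennreal"
  assumes A[measurable]: "case_prod A \<in> borel_measurable (borel \<Otimes>\<^sub>M borel)"
    and B[measurable]: "case_prod B \<in> borel_measurable (borel \<Otimes>\<^sub>M borel)"
    and qA: "\<And>s t. q s t \<le> (\<integral>\<^sup>+s. A s t \<partial>lborel)"
    and qB: "\<And>s t. q s t \<le> (\<integral>\<^sup>+t. B s t \<partial>lborel)"
  shows "(\<integral>\<^sup>+s. \<integral>\<^sup>+t. (q s t)\<^sup>2 \<partial>lborel \<partial>lborel)
    \<le> (\<integral>\<^sup>+s. \<integral>\<^sup>+t. A s t \<partial>lborel \<partial>lborel) * (\<integral>\<^sup>+s. \<integral>\<^sup>+t. B s t \<partial>lborel \<partial>lborel)"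
proof -
  have "(\<integral>\<^sup>+s. \<integral>\<^sup>+t. (q s t)\<^sup>2 \<partial>lborel \<partial>lborel)
      \<le> (\<integral>\<^sup>+s. \<integral>\<^sup>+t. (\<integral>\<^sup>+s'. A s' t \<partial>lborel) * (\<integral>\<^sup>+t'. B s t' \<partial>lborel) \<partial>lborel \<partial>lborel)"
    unfolding power2_eq_square by (intro nn_integral_mono mult_mono qA qB) auto
  also have "\<dots> = (\<integral>\<^sup>+t. \<integral>\<^sup>+s. A s t \<partial>lborel \<partial>lborel) * (\<integral>\<^sup>+s. \<integral>\<^sup>+t. B s t \<partial>lborel \<partial>lborel)"
    by (subst nn_integral_multc, measurable, subst nn_integral_cmult, measurable)
  also have "(\<integral>\<^sup>+t. \<integral>\<^sup>+s. A s t \<partial>lborel \<partial>lborel) = (\<integral>\<^sup>+s. \<integral>\<^sup>+t. A s t \<partial>lborel \<partial>lborel)"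
    by (rule lborel_pair.Fubini') simp
  finally show ?thesis .
qed

section \<open>Pointwise bounds by line integrals and the resulting fourth-power estimates\<close>

lemma test_fun_line_derivative:
  assumes f: "test_fun \<Omega> f"
  shows "((\<lambda>s. f (x + s *\<^sub>R i)) has_real_derivative frechet_derivative f (at (x + s *\<^sub>R i)) i) (at s)"
proof -
  have "((\<lambda>s. f (x + s *\<^sub>R i)) has_derivative (\<lambda>h. frechet_derivative f (at (x + s *\<^sub>R i)) (h *\<^sub>R i))) (at s)"
    by (rule has_derivative_compose[OF _ test_fun_has_derivative[OF f]])
       (auto intro!: derivative_eq_intros)
  moreover have "frechet_derivative f (at (x + s *\<^sub>R i)) (h *\<^sub>R i)
      = frechet_derivative f (at (x + s *\<^sub>R i)) i * h" for h
    using linear_scale[OF has_derivative_linear[OF test_fun_has_derivative[OF f]]] by simp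
  ultimately show ?thesis
    by (simp add: has_field_derivative_def)
qed

text \<open>Along the line the square of \<open>f\<close> has derivative
  \<open>2 f \<partial>\<^sub>i f\<close>. Integrating it from a point outside the support up to
  \<open>t\<close> and enlarging the range to the whole line gives the bound.\<close>

lemma test_fun_square_le_line_integral:
  assumes f: "test_fun \<Omega> f" and i: "i \<in> Basis"
  shows "ennreal ((f (x + t *\<^sub>R i))\<^sup>2) \<le>
    (\<integral>\<^sup>+s. ennreal (2 * \<bar>f (x + s *\<^sub>R i)\<bar> * \<bar>frechet_derivative f (at (x + s *\<^sub>R i)) i\<bar>) \<partial>lborel)"
proof -
  define F where "F s = (f (x + s *\<^sub>R i))\<^sup>2" for s
  define F' where "F' s = 2 * f (x + s *\<^sub>R i) * frechet_derivative f (at (x + s *\<^sub>R i)) i" for s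
  obtain r where r: "r > 0" "\<And>x. norm x > r \<Longrightarrow> f x = 0"
    using test_fun_support_ball[OF f] by blast
  \<comment> \<open>This choice gives \<bar>a\<bar> - norm x > r, so the starting point lies outside
    the ball containing the support, and the summand \<bar>t\<bar> ensures a \<le> t.\<close>
  define a where "a = - (r + norm x + \<bar>t\<bar> + 1)"
  have "a \<le> t" unfolding a_def using r(1) norm_ge_zero[of x] by linarith
  have "norm (x + a *\<^sub>R i) \<ge> norm (a *\<^sub>R i) - norm x"
    by (metis add.commute norm_diff_ineq)
  then have "norm (x + a *\<^sub>R i) > r"
    using i r(1) by (simp add: a_def)
  then have Fa: "F a = 0" using r by (simp add: F_def)
  have D: "(F has_real_derivative F' s) (at s)" for s
    unfolding F_def F'_def using test_fun_line_derivative[OF f, of x i s]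
    by (auto intro!: derivative_eq_intros)
  have cont: "continuous_on UNIV F'"
    unfolding F'_def
    by (intro continuous_intros continuous_on_compose2[OF test_fun_continuous[OF f]]
        continuous_on_compose2[OF test_fun_continuous[OF test_fun_partial[OF f i]]]) auto
  have m[measurable]: "F' \<in> borel_measurable borel"
    using cont by (rule borel_measurable_continuous_onI)
  have "(\<integral>s. F' s * indicator {a..t} s \<partial>lborel) = F t - F a"
    by (rule integral_FTC_Icc_real[OF \<open>a \<le> t\<close>])
       (use D cont in \<open>auto simp: continuous_on_eq_continuous_at\<close>)
  then have "ennreal (F t) = ennreal \<bar>\<integral>s. F' s * indicator {a..t} s \<partial>lborel\<bar>"
    using Fa by (simp add: F_def)
  \<comment> \<open>For a non-integrable integrand the Bochner integral is 0 by convention, so the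
    bound holds in both cases.\<close>
  also have "\<dots> \<le> (\<integral>\<^sup>+s. ennreal (norm (F' s * indicator {a..t} s)) \<partial>lborel)"
    using integral_norm_bound_ennreal[of lborel "\<lambda>s. F' s * indicator {a..t} s"]
    by (cases "integrable lborel (\<lambda>s. F' s * indicator {a..t} s)")
       (simp only: real_norm_def, subst not_integrable_integral_eq, simp_all)
  also have "\<dots> \<le> (\<integral>\<^sup>+s. ennreal \<bar>F' s\<bar> \<partial>lborel)"
    by (intro nn_integral_mono) (auto simp: indicator_def)
  finally show ?thesis by (simp add: F_def F'_def abs_mult)
qed

lemma ennreal_two_mult_le: "ennreal (2 * \<bar>x\<bar> * \<bar>y\<bar>) \<le> ennreal (x\<^sup>2) + ennreal (y\<^sup>2)"
  using sum_squares_bound[of "\<bar>x\<bar>" "\<bar>y\<bar>"] by (simp flip: ennreal_plus add: ennreal_leI)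

text \<open>Extended nonnegative reals do not allow expanding the square of a difference; the larger
  of the two factors is squared instead.\<close>

lemma ennreal_mult_le_squares: "a * b \<le> a\<^sup>2 + (b::ennreal)\<^sup>2"
proof (cases "a \<le> b")
  case True
  then have "a * b \<le> b\<^sup>2" by (simp add: power2_eq_square mult_right_mono)
  then show ?thesis by (simp add: add_increasing)
next
  case False
  then have "a * b \<le> a\<^sup>2" by (simp add: power2_eq_square mult_left_mono)
  then show ?thesis by (simp add: add_increasing2)
qed

text \<open>The square of \<open>f\<close> at a point is at most the line integral of
  \<open>R a\<close> in direction \<open>a\<close>, and likewise for \<open>b\<close>. Multiplying
  the two bounds makes the integral of the fourth power factorize.\<close>

lemma ladyzhenskaya2:
  fixes f :: "'a::euclidean_space \<Rightarrow> real"
  assumes B: "(Basis::'a set) = {a, b}" "a \<noteq> b" and f: "test_fun \<Omega> f"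
  defines "R \<equiv> \<lambda>i x. ennreal (2 * \<bar>f x\<bar> * \<bar>frechet_derivative f (at x) i\<bar>)"
  shows "(\<integral>\<^sup>+x. ennreal ((f x)^4) \<partial>lborel) \<le> (\<integral>\<^sup>+x. R a x \<partial>lborel) * (\<integral>\<^sup>+x. R b x \<partial>lborel)"
proof -
  note [measurable] = test_fun_measurable[OF f] test_fun_measurable[OF test_fun_partial[OF f]]
  have i: "a \<in> Basis" "b \<in> Basis" using B by auto
  have [measurable]: "R a \<in> borel_measurable borel" "R b \<in> borel_measurable borel"
    unfolding R_def using i by measurable
  have "(\<integral>\<^sup>+x. ennreal ((f x)^4) \<partial>lborel) =
      (\<integral>\<^sup>+s. \<integral>\<^sup>+t. (ennreal ((f (s *\<^sub>R a + t *\<^sub>R b))\<^sup>2))\<^sup>2 \<partial>lborel \<partial>lborel)"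
    by (subst nn_integral_lborel_basis2[OF B]) (auto simp: ennreal_power)
  also have "\<dots> \<le> (\<integral>\<^sup>+s. \<integral>\<^sup>+t. R a (s *\<^sub>R a + t *\<^sub>R b) \<partial>lborel \<partial>lborel)
      * (\<integral>\<^sup>+s. \<integral>\<^sup>+t. R b (s *\<^sub>R a + t *\<^sub>R b) \<partial>lborel \<partial>lborel)"
  proof (rule nn_integral_square_le_product)
    show "ennreal ((f (s *\<^sub>R a + t *\<^sub>R b))\<^sup>2) \<le> (\<integral>\<^sup>+s. R a (s *\<^sub>R a + t *\<^sub>R b) \<partial>lborel)" for s t
      using test_fun_square_le_line_integral[OF f i(1), of "t *\<^sub>R b" s]
      by (simp add: R_def add.commute)
    show "ennreal ((f (s *\<^sub>R a + t *\<^sub>R b))\<^sup>2) \<le> (\<integral>\<^sup>+t. R b (s *\<^sub>R a + t *\<^sub>R b) \<partial>lborel)" for s t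
      using test_fun_square_le_line_integral[OF f i(2), of "s *\<^sub>R a" t]
      by (simp add: R_def)
  qed measurable
  also have "\<dots> = (\<integral>\<^sup>+x. R a x \<partial>lborel) * (\<integral>\<^sup>+x. R b x \<partial>lborel)"
    by (subst (1 2) nn_integral_lborel_basis2[OF B]) auto
  finally show ?thesis .
qed

text \<open>On each plane orthogonal to \<open>c\<close> the planar argument and the Cauchy-Schwarz inequality bound
  \<open>\<integral>f\<^sup>4\<close> by a multiple of \<open>\<integral>f\<^sup>2\<close> times the sum of \<open>\<integral>|\<partial>\<^sub>a f|\<^sup>2\<close> and \<open>\<integral>|\<partial>\<^sub>b f|\<^sup>2\<close>; the factor \<open>\<integral>f\<^sup>2\<close> is bounded
  uniformly over the planes by integrating along \<open>c\<close>.\<close>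
lemma ladyzhenskaya3:
  fixes f :: "'a::euclidean_space \<Rightarrow> real"
  assumes B: "(Basis::'a set) = {a, b, c}" "a \<noteq> b" "a \<noteq> c" "b \<noteq> c" and f: "test_fun \<Omega> f"
  defines "f' \<equiv> \<lambda>i x. frechet_derivative f (at x) i"
  shows "(\<integral>\<^sup>+x. ennreal ((f x)^4) \<partial>lborel) \<le> 4 * (\<integral>\<^sup>+x. ennreal (2 * \<bar>f x\<bar> * \<bar>f' c x\<bar>) \<partial>lborel)
    * ((\<integral>\<^sup>+x. ennreal ((f' a x)\<^sup>2) \<partial>lborel) + (\<integral>\<^sup>+x. ennreal ((f' b x)\<^sup>2) \<partial>lborel))"
proof -
  have i: "a \<in> Basis" "b \<in> Basis" "c \<in> Basis" using B by auto
  have [measurable]: "f \<in> borel_measurable borel" using test_fun_measurable[OF f] .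
  have f'[measurable]: "f' a \<in> borel_measurable borel" "f' b \<in> borel_measurable borel" "f' c \<in> borel_measurable borel"
    using test_fun_measurable[OF test_fun_partial[OF f]] i by (simp_all add: f'_def)
  define X where "X r s t = r *\<^sub>R c + (s *\<^sub>R a + t *\<^sub>R b)" for r s t
  \<comment> \<open>Allowing arbitrary measurable functions in the three slots covers every order of
    integration used below.\<close>
  have [measurable]: "(\<lambda>z. X (g z) (h z) (l z)) \<in> borel_measurable M"
    if [measurable]: "g \<in> borel_measurable M" "h \<in> borel_measurable M" "l \<in> borel_measurable M"
    for M and g h l :: "'z \<Rightarrow> real"
    unfolding X_def by measurable
  define R where "R i x = ennreal (2 * \<bar>f x\<bar> * \<bar>f' i x\<bar>)" for i x
  have [measurable]: "R a \<in> borel_measurable borel" "R b \<in> borel_measurable borel" "R c \<in> borel_measurable borel"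
    unfolding R_def by measurable
  define K where "K = (\<integral>\<^sup>+x. R c x \<partial>lborel)"
  define P where "P i r = (\<integral>\<^sup>+s. \<integral>\<^sup>+t. R i (X r s t) \<partial>lborel \<partial>lborel)" for i r
  define D where "D i r = (\<integral>\<^sup>+s. \<integral>\<^sup>+t. ennreal ((f' i (X r s t))\<^sup>2) \<partial>lborel \<partial>lborel)" for i r
  define M where "M r = (\<integral>\<^sup>+s. \<integral>\<^sup>+t. ennreal ((f (X r s t))\<^sup>2) \<partial>lborel \<partial>lborel)" for r
  note basis3 = nn_integral_lborel_basis3[OF B, folded X_def]
  have MK: "M r \<le> K" for r
  proof -
    have "M r \<le> (\<integral>\<^sup>+s. \<integral>\<^sup>+t. \<integral>\<^sup>+r. R c (X r s t) \<partial>lborel \<partial>lborel \<partial>lborel)"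
      unfolding M_def
    proof (intro nn_integral_mono)
      show "ennreal ((f (X r s t))\<^sup>2) \<le> (\<integral>\<^sup>+r. R c (X r s t) \<partial>lborel)" for s t
        using test_fun_square_le_line_integral[OF f i(3), of "s *\<^sub>R a + t *\<^sub>R b" r]
        by (simp add: R_def X_def f'_def add.commute)
    qed
    \<comment> \<open>Two exchanges move the integration along \<open>c\<close> from the innermost
      to the outermost position, which is the order in \<open>basis3\<close>.\<close>
    also have "\<dots> = (\<integral>\<^sup>+s. \<integral>\<^sup>+r. \<integral>\<^sup>+t. R c (X r s t) \<partial>lborel \<partial>lborel \<partial>lborel)"
      by (intro nn_integral_cong lborel_pair.Fubini') measurable
    also have "\<dots> = (\<integral>\<^sup>+r. \<integral>\<^sup>+s. \<integral>\<^sup>+t. R c (X r s t) \<partial>lborel \<partial>lborel \<partial>lborel)"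
      by (intro lborel_pair.Fubini') measurable
    also have "\<dots> = K" unfolding K_def by (subst basis3) auto
    finally show ?thesis .
  qed
  have PD: "(P i r)\<^sup>2 \<le> 4 * K * D i r" if [measurable]: "f' i \<in> borel_measurable borel" for i r
  proof -
    have "P i r = (\<integral>\<^sup>+z. R i (X r (fst z) (snd z)) \<partial>(lborel \<Otimes>\<^sub>M lborel))"
      unfolding P_def R_def by (subst lborel.nn_integral_fst[symmetric]) auto
    also have "\<dots> = (\<integral>\<^sup>+z. ennreal (2 * \<bar>f (X r (fst z) (snd z))\<bar>) * ennreal \<bar>f' i (X r (fst z) (snd z))\<bar>
        \<partial>(lborel \<Otimes>\<^sub>M lborel))"
      unfolding R_def by (simp add: ennreal_mult)
    also have "(\<dots>)\<^sup>2 \<le> (\<integral>\<^sup>+z. (ennreal (2 * \<bar>f (X r (fst z) (snd z))\<bar>))\<^sup>2 \<partial>(lborel \<Otimes>\<^sub>M lborel))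
      * (\<integral>\<^sup>+z. (ennreal \<bar>f' i (X r (fst z) (snd z))\<bar>)\<^sup>2 \<partial>(lborel \<Otimes>\<^sub>M lborel))"
      by (intro Cauchy_Schwarz_nn_integral) measurable
    also have "(\<integral>\<^sup>+z. (ennreal \<bar>f' i (X r (fst z) (snd z))\<bar>)\<^sup>2 \<partial>(lborel \<Otimes>\<^sub>M lborel)) = D i r"
      unfolding D_def by (subst lborel.nn_integral_fst[symmetric]) (auto simp: ennreal_power)
    also have "(\<integral>\<^sup>+z. (ennreal (2 * \<bar>f (X r (fst z) (snd z))\<bar>))\<^sup>2 \<partial>(lborel \<Otimes>\<^sub>M lborel))
      = (\<integral>\<^sup>+z. 4 * ennreal ((f (X r (fst z) (snd z)))\<^sup>2) \<partial>(lborel \<Otimes>\<^sub>M lborel))"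
      by (intro nn_integral_cong) (simp add: ennreal_power ennreal_mult power_mult_distrib)
    also have "\<dots> = 4 * (\<integral>\<^sup>+z. ennreal ((f (X r (fst z) (snd z)))\<^sup>2) \<partial>(lborel \<Otimes>\<^sub>M lborel))"
      by (rule nn_integral_cmult) measurable
    also have "(\<integral>\<^sup>+z. ennreal ((f (X r (fst z) (snd z)))\<^sup>2) \<partial>(lborel \<Otimes>\<^sub>M lborel)) = M r"
      unfolding M_def by (subst lborel.nn_integral_fst[symmetric]) auto
    also have "4 * M r * D i r \<le> 4 * K * D i r"
      by (intro mult_right_mono mult_left_mono MK) auto
    finally show ?thesis .
  qed
  have "(\<integral>\<^sup>+x. ennreal ((f x)^4) \<partial>lborel) =
      (\<integral>\<^sup>+r. \<integral>\<^sup>+s. \<integral>\<^sup>+t. (ennreal ((f (X r s t))\<^sup>2))\<^sup>2 \<partial>lborel \<partial>lborel \<partial>lborel)"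
    by (subst basis3) (auto simp: ennreal_power)
  also have "\<dots> \<le> (\<integral>\<^sup>+r. P a r * P b r \<partial>lborel)"
  proof (intro nn_integral_mono, unfold P_def, rule nn_integral_square_le_product)
    show "ennreal ((f (X r s t))\<^sup>2) \<le> (\<integral>\<^sup>+s. R a (X r s t) \<partial>lborel)" for r s t
      using test_fun_square_le_line_integral[OF f i(1), of "r *\<^sub>R c + t *\<^sub>R b" s]
      by (simp add: R_def X_def f'_def add_ac)
    show "ennreal ((f (X r s t))\<^sup>2) \<le> (\<integral>\<^sup>+t. R b (X r s t) \<partial>lborel)" for r s t
      using test_fun_square_le_line_integral[OF f i(2), of "r *\<^sub>R c + s *\<^sub>R a" t]
      by (simp add: R_def X_def f'_def add_ac)
  qed measurable
  \<comment> \<open>Splitting the product into squares before integrating over \<open>r\<close>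
    makes each \<open>D i r\<close> enter linearly, so its integral is that of a squared partial
    derivative over the whole space.\<close>
  also have "\<dots> \<le> (\<integral>\<^sup>+r. 4 * K * D a r + 4 * K * D b r \<partial>lborel)"
    by (intro nn_integral_mono order_trans[OF ennreal_mult_le_squares] add_mono PD f')
  also have "\<dots> = 4 * K * (\<integral>\<^sup>+r. D a r \<partial>lborel) + 4 * K * (\<integral>\<^sup>+r. D b r \<partial>lborel)"
    unfolding D_def by (simp add: nn_integral_add nn_integral_cmult)
  also have "(\<integral>\<^sup>+r. D a r \<partial>lborel) = (\<integral>\<^sup>+x. ennreal ((f' a x)\<^sup>2) \<partial>lborel)"
    unfolding D_def by (subst basis3) auto
  also have "(\<integral>\<^sup>+r. D b r \<partial>lborel) = (\<integral>\<^sup>+x. ennreal ((f' b x)\<^sup>2) \<partial>lborel)"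
    unfolding D_def by (subst basis3) auto
  finally show ?thesis by (simp add: K_def R_def distrib_left)
qed

text \<open>\<open>Q\<close> is the squared H^1 norm. Since 2\<bar>x\<bar>\<bar>y\<bar> \<le> x^2 +
  y^2, it dominates every factor in the two- and three-dimensional estimates, which yields one bound
  for both dimensions.\<close>

lemma ladyzhenskaya:
  fixes f :: "'a::euclidean_space \<Rightarrow> real"
  assumes dim: "DIM('a) = 2 \<or> DIM('a) = 3" and f: "test_fun \<Omega> f"
  defines "Q \<equiv> (\<integral>\<^sup>+x. ennreal ((f x)\<^sup>2) \<partial>lborel)
    + (\<Sum>i\<in>Basis. \<integral>\<^sup>+x. ennreal ((frechet_derivative f (at x) i)\<^sup>2) \<partial>lborel)"
  shows "(\<integral>\<^sup>+x. ennreal ((f x)^4) \<partial>lborel) \<le> 4 * Q\<^sup>2"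
proof -
  have [measurable]: "f \<in> borel_measurable borel"
    "i \<in> Basis \<Longrightarrow> (\<lambda>x. frechet_derivative f (at x) i) \<in> borel_measurable borel" for i
    using test_fun_measurable[OF f] test_fun_measurable[OF test_fun_partial[OF f]] by auto
  have R: "(\<integral>\<^sup>+x. ennreal (2 * \<bar>f x\<bar> * \<bar>frechet_derivative f (at x) i\<bar>) \<partial>lborel) \<le> Q" if "i \<in> Basis" for i
  proof -
    have "(\<integral>\<^sup>+x. ennreal (2 * \<bar>f x\<bar> * \<bar>frechet_derivative f (at x) i\<bar>) \<partial>lborel)
      \<le> (\<integral>\<^sup>+x. ennreal ((f x)\<^sup>2) + ennreal ((frechet_derivative f (at x) i)\<^sup>2) \<partial>lborel)"
      by (intro nn_integral_mono ennreal_two_mult_le)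
    also have "\<dots> = (\<integral>\<^sup>+x. ennreal ((f x)\<^sup>2) \<partial>lborel) + (\<integral>\<^sup>+x. ennreal ((frechet_derivative f (at x) i)\<^sup>2) \<partial>lborel)"
      using that by (subst nn_integral_add) auto
    also have "\<dots> \<le> Q"
      unfolding Q_def using that by (intro add_mono order_refl member_le_sum) auto
    finally show ?thesis .
  qed
  from dim show ?thesis
  proof
    assume "DIM('a) = 2"
    then obtain a b where B: "(Basis::'a set) = {a, b}" "a \<noteq> b"
      by (auto simp: card_2_iff)
    have "(\<integral>\<^sup>+x. ennreal ((f x)^4) \<partial>lborel) \<le> Q * Q"
      using B by (intro order_trans[OF ladyzhenskaya2[OF B f]] mult_mono R) auto
    also have "\<dots> = 1 * Q\<^sup>2" by (simp add: power2_eq_square)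
    also have "\<dots> \<le> 4 * Q\<^sup>2" by (intro mult_right_mono) auto
    finally show ?thesis .
  next
    assume "DIM('a) = 3"
    then obtain a b c where B: "(Basis::'a set) = {a, b, c}" "a \<noteq> b" "a \<noteq> c" "b \<noteq> c"
      by (auto simp: card_3_iff)
    have "(\<integral>\<^sup>+x. ennreal ((frechet_derivative f (at x) a)\<^sup>2) \<partial>lborel)
        + (\<integral>\<^sup>+x. ennreal ((frechet_derivative f (at x) b)\<^sup>2) \<partial>lborel) \<le> Q"
      unfolding Q_def using B by (simp add: B(1) add_increasing add_increasing2 add.assoc[symmetric])
    then have "(\<integral>\<^sup>+x. ennreal ((f x)^4) \<partial>lborel) \<le> 4 * Q * Q"
      using B by (intro order_trans[OF ladyzhenskaya3[OF B f]] mult_mono R) auto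
    then show ?thesis by (simp add: power2_eq_square mult.assoc)
  qed
qed

section \<open>Square integrable functions\<close>

lemma L2_measurable: "L2 \<Omega> f \<Longrightarrow> f \<in> borel_measurable (lebesgue_on \<Omega>)"
  by (simp add: L2_def)

lemma L2_square_integrable: "L2 \<Omega> f \<Longrightarrow> integrable (lebesgue_on \<Omega>) (\<lambda>x. (f x)\<^sup>2)"
  by (simp add: L2_def)

lemma L2_mult_integrable:
  assumes "L2 \<Omega> f" "L2 \<Omega> g"
  shows "integrable (lebesgue_on \<Omega>) (\<lambda>x. f x * g x)"
proof (rule Bochner_Integration.integrable_bound)
  show "integrable (lebesgue_on \<Omega>) (\<lambda>x. (f x)\<^sup>2 + (g x)\<^sup>2)"
    using assms by (simp add: L2_def)
  show "(\<lambda>x. f x * g x) \<in> borel_measurable (lebesgue_on \<Omega>)"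
    using assms by (auto simp: L2_def)
  have "\<bar>a * b\<bar> \<le> a\<^sup>2 + b\<^sup>2" for a b :: real
    using sum_squares_bound[of "\<bar>a\<bar>" "\<bar>b\<bar>"] mult_nonneg_nonneg[of "\<bar>a\<bar>" "\<bar>b\<bar>"]
    unfolding abs_mult power2_abs by linarith
  then show "AE x in lebesgue_on \<Omega>. norm (f x * g x) \<le> norm ((f x)\<^sup>2 + (g x)\<^sup>2)"
    by simp
qed

lemma L2_bounded_mult:
  assumes f: "L2 \<Omega> f" and h: "h \<in> borel_measurable (lebesgue_on \<Omega>)" and B: "\<And>x. \<bar>h x\<bar> \<le> B"
  shows "L2 \<Omega> (\<lambda>x. h x * f x)"
  unfolding L2_def
proof
  show m: "(\<lambda>x. h x * f x) \<in> borel_measurable (lebesgue_on \<Omega>)"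
    using f h by (auto simp: L2_def)
  show "integrable (lebesgue_on \<Omega>) (\<lambda>x. (h x * f x)\<^sup>2)"
  proof (rule Bochner_Integration.integrable_bound)
    show "integrable (lebesgue_on \<Omega>) (\<lambda>x. B\<^sup>2 * (f x)\<^sup>2)"
      using f by (simp add: L2_def)
    have "(h x)\<^sup>2 \<le> B\<^sup>2" for x
      using B[of x] by (metis abs_ge_zero power2_abs power_mono)
    then show "AE x in lebesgue_on \<Omega>. norm ((h x * f x)\<^sup>2) \<le> norm (B\<^sup>2 * (f x)\<^sup>2)"
      by (simp add: power_mult_distrib mult_right_mono)
  qed (use m in simp)
qed

lemma L2_cmult: "L2 \<Omega> f \<Longrightarrow> L2 \<Omega> (\<lambda>x. c * f x)"
  by (rule L2_bounded_mult[where B = "\<bar>c\<bar>"]) auto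

lemma L2_add: "L2 \<Omega> f \<Longrightarrow> L2 \<Omega> g \<Longrightarrow> L2 \<Omega> (\<lambda>x. f x + g x)"
  using L2_mult_integrable[of \<Omega> f g] by (auto simp: L2_def power2_sum mult.assoc)

lemma L2_diff: "L2 \<Omega> f \<Longrightarrow> L2 \<Omega> g \<Longrightarrow> L2 \<Omega> (\<lambda>x. f x - g x)"
  using L2_add[of \<Omega> f "\<lambda>x. - 1 * g x"] L2_cmult[of \<Omega> g "-1"] by simp

lemma L2_sum: "(\<And>i. i \<in> I \<Longrightarrow> L2 \<Omega> (f i)) \<Longrightarrow> L2 \<Omega> (\<lambda>x. \<Sum>i\<in>I. f i x)"
proof (induction I rule: infinite_finite_induct)
  case (insert i I)
  then show ?case by (simp add: L2_add)
qed (simp_all add: L2_def)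

lemma L2_dominated:
  assumes "L2 \<Omega> f" and g: "g \<in> borel_measurable (lebesgue_on \<Omega>)" and "\<And>x. \<bar>g x\<bar> \<le> \<bar>f x\<bar>"
  shows "L2 \<Omega> g"
  unfolding L2_def
proof
  show "integrable (lebesgue_on \<Omega>) (\<lambda>x. (g x)\<^sup>2)"
    by (rule Bochner_Integration.integrable_bound[OF L2_square_integrable[OF assms(1)]])
       (use assms in \<open>auto simp: abs_le_square_iff\<close>)
qed (rule g)

text \<open>The inequality for nonnegative extended integrals is applied to the absolute values and
  transferred to the reals, all quantities being finite.\<close>

lemma L2_Cauchy_Schwarz:
  assumes f: "L2 \<Omega> f" and g: "L2 \<Omega> g"
  shows "(LINT x|lebesgue_on \<Omega>. f x * g x)\<^sup>2
    \<le> (LINT x|lebesgue_on \<Omega>. (f x)\<^sup>2) * (LINT x|lebesgue_on \<Omega>. (g x)\<^sup>2)"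
proof -
  let ?M = "lebesgue_on \<Omega>"
  have i: "integrable ?M (\<lambda>x. f x * g x)" by (rule L2_mult_integrable[OF f g])
  have "ennreal ((LINT x|?M. \<bar>f x * g x\<bar>)\<^sup>2) = (\<integral>\<^sup>+x. ennreal \<bar>f x * g x\<bar> \<partial>?M)\<^sup>2"
    using i by (subst nn_integral_eq_integral) (auto simp: ennreal_power)
  also have "\<dots> = (\<integral>\<^sup>+x. ennreal \<bar>f x\<bar> * ennreal \<bar>g x\<bar> \<partial>?M)\<^sup>2"
    by (simp add: abs_mult ennreal_mult)
  also have "\<dots> \<le> (\<integral>\<^sup>+x. (ennreal \<bar>f x\<bar>)\<^sup>2 \<partial>?M) * (\<integral>\<^sup>+x. (ennreal \<bar>g x\<bar>)\<^sup>2 \<partial>?M)"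
    using f g by (intro Cauchy_Schwarz_nn_integral) (auto simp: L2_def)
  also have "\<dots> = ennreal ((LINT x|?M. (f x)\<^sup>2) * (LINT x|?M. (g x)\<^sup>2))"
    using f g by (simp add: ennreal_power nn_integral_eq_integral L2_def ennreal_mult)
  finally have "(LINT x|?M. \<bar>f x * g x\<bar>)\<^sup>2 \<le> (LINT x|?M. (f x)\<^sup>2) * (LINT x|?M. (g x)\<^sup>2)"
    by (subst (asm) ennreal_le_iff) auto
  moreover have "(LINT x|?M. f x * g x)\<^sup>2 \<le> (LINT x|?M. \<bar>f x * g x\<bar>)\<^sup>2"
    by (rule abs_le_square_iff[THEN iffD1]) (use integral_abs_bound[of ?M "\<lambda>x. f x * g x"] in linarith)
  ultimately show ?thesis by linarith
qed

text \<open>By Cauchy-Schwarz the difference of the integrals is at most the L^2 distance of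
  \<open>a m\<close> and \<open>a'\<close> times the norm of \<open>b\<close>. Integrals of products
  are passed to the limit below by this lemma.\<close>

lemma L2_limit_mult:
  assumes a: "\<And>m. L2 \<Omega> (a m)" and a': "L2 \<Omega> a'" and b: "L2 \<Omega> b"
    and lim: "(\<lambda>m::nat. LINT x|lebesgue_on \<Omega>. (a m x - a' x)\<^sup>2) \<longlonglongrightarrow> 0"
  shows "(\<lambda>m. LINT x|lebesgue_on \<Omega>. a m x * b x) \<longlonglongrightarrow> (LINT x|lebesgue_on \<Omega>. a' x * b x)"
proof -
  let ?M = "lebesgue_on \<Omega>"
  let ?d = "\<lambda>m. LINT x|?M. (a m x - a' x) * b x"
  have d: "?d m = (LINT x|?M. a m x * b x) - (LINT x|?M. a' x * b x)" for m
    unfolding left_diff_distrib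
    by (rule Bochner_Integration.integral_diff) (intro L2_mult_integrable a a' b)+
  have "(\<lambda>m. (?d m)\<^sup>2) \<longlonglongrightarrow> 0"
  proof (rule tendsto_sandwich[OF _ _ tendsto_const])
    show "(\<lambda>m. (LINT x|?M. (a m x - a' x)\<^sup>2) * (LINT x|?M. (b x)\<^sup>2)) \<longlonglongrightarrow> 0"
      using tendsto_mult_left_zero[OF lim] .
    show "\<forall>\<^sub>F m in sequentially. (?d m)\<^sup>2 \<le> (LINT x|?M. (a m x - a' x)\<^sup>2) * (LINT x|?M. (b x)\<^sup>2)"
      by (intro always_eventually allI L2_Cauchy_Schwarz L2_diff a a' b)
  qed auto
  then have "(\<lambda>m. sqrt ((?d m)\<^sup>2)) \<longlonglongrightarrow> 0"
    using tendsto_real_sqrt by fastforce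
  then have "?d \<longlonglongrightarrow> 0" by (simp add: tendsto_rabs_zero_iff)
  then show ?thesis unfolding d by (simp add: LIM_zero_iff)
qed

section \<open>Integration by parts for test functions\<close>

text \<open>Difference quotients have integral 0 by translation invariance, and they converge to the
  partial derivative under a common integrable bound.\<close>

lemma integral_test_fun_partial:
  assumes f: "test_fun \<Omega> f" and i: "i \<in> Basis"
  shows "(LINT x|lborel. frechet_derivative f (at x) i) = 0"
proof -
  define h where "h n = 1 / real (Suc n)" for n
  define d where "d n x = (f (x + h n *\<^sub>R i) - f x) / h n" for n x
  have h: "h n > 0" "h n \<le> 1" for n by (simp_all add: h_def)
  have [measurable]: "f \<in> borel_measurable borel" using test_fun_measurable[OF f] .
  obtain r where r: "r > 0" "\<And>x. norm x > r \<Longrightarrow> f x = 0"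
    using test_fun_support_ball[OF f] by blast
  obtain B where B: "\<And>x. \<bar>frechet_derivative f (at x) i\<bar> \<le> B"
    using test_fun_bounded[OF test_fun_partial[OF f i]] by blast
  have shift: "integrable lborel (\<lambda>x. f (x + c))" "(LINT x|lborel. f (x + c)) = (LINT x|lborel. f x)" for c
  proof -
    have "integrable (distr lborel borel ((+) c)) f"
      using test_fun_integrable_lborel[OF f] by (simp add: lborel_distr_plus)
    then show "integrable lborel (\<lambda>x. f (x + c))"
      by (subst (asm) integrable_distr_eq) (auto simp: add.commute)
    have "(LINT x|distr lborel borel ((+) c). f x) = (LINT x|lborel. f (x + c))"
      by (subst integral_distr) (auto simp: add.commute)
    then show "(LINT x|lborel. f (x + c)) = (LINT x|lborel. f x)"
      by (simp add: lborel_distr_plus)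
  qed
  have "(LINT x|lborel. d n x) = 0" for n
    unfolding d_def using shift test_fun_integrable_lborel[OF f] by simp
  moreover have "(\<lambda>n. LINT x|lborel. d n x) \<longlonglongrightarrow> (LINT x|lborel. frechet_derivative f (at x) i)"
  \<comment> \<open>The shifts have length at most 1, so enlarging the radius of the support ball by
    1 contains the supports of all difference quotients. The height \<open>B\<close> comes from the
    mean value theorem.\<close>
  proof (rule integral_dominated_convergence[where w = "\<lambda>x. B * indicator (cball 0 (r + 1)) x"])
    show "(\<lambda>x. frechet_derivative f (at x) i) \<in> borel_measurable lborel"
      using test_fun_measurable[OF test_fun_partial[OF f i]] by simp
    show "d n \<in> borel_measurable lborel" for n unfolding d_def by measurable
    show "integrable lborel (\<lambda>x. B * indicator (cball 0 (r + 1)) x)"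
      by (intro integrable_mult_right integrable_real_indicator)
         (use emeasure_bounded_finite[of "cball 0 (r + 1)"] in auto)
    have "(\<lambda>n. d n x) \<longlonglongrightarrow> frechet_derivative f (at x) i" for x
    proof -
      have "((\<lambda>s. (f (x + s *\<^sub>R i) - f x) / s) \<longlongrightarrow> frechet_derivative f (at x) i) (at 0)"
        using test_fun_line_derivative[OF f, of x i 0] by (simp add: DERIV_def)
      moreover have "filterlim h (at 0) sequentially"
        unfolding filterlim_at h_def using LIMSEQ_inverse_real_of_nat
        by (auto simp: inverse_eq_divide)
      ultimately show ?thesis
        unfolding d_def by (rule filterlim_compose)
    qed
    then show "AE x in lborel. (\<lambda>n. d n x) \<longlonglongrightarrow> frechet_derivative f (at x) i" by simp
    have "\<bar>d n x\<bar> \<le> B * indicator (cball 0 (r + 1)) x" for n x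
    proof (cases "norm x \<le> r + 1")
      case True
      obtain z where "f (x + h n *\<^sub>R i) - f (x + 0 *\<^sub>R i)
          = (h n - 0) * frechet_derivative f (at (x + z *\<^sub>R i)) i"
        using MVT2[OF h(1) test_fun_line_derivative[OF f, of x i]] by blast
      then have "d n x = frechet_derivative f (at (x + z *\<^sub>R i)) i"
        using h(1)[of n] by (simp add: d_def)
      then show ?thesis using B True by simp
    next
      case False
      have "norm (x + h n *\<^sub>R i) \<ge> norm x - norm (h n *\<^sub>R i)" by (rule norm_diff_ineq)
      then have "norm (x + h n *\<^sub>R i) > r" using False h[of n] i by simp
      then show ?thesis using False r by (simp add: d_def)
    qed
    then show "AE x in lborel. norm (d n x) \<le> B * indicator (cball 0 (r + 1)) x" for n by simp
  qed
  ultimately show ?thesis by (simp add: LIMSEQ_const_iff)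
qed

lemma frechet_derivative_mult_test:
  assumes "test_fun \<Omega> f" "test_fun \<Omega> g"
  shows "frechet_derivative (\<lambda>x. f x * g x) (at x) i
    = f x * frechet_derivative g (at x) i + frechet_derivative f (at x) i * g x"
  using frechet_derivative_at[OF has_derivative_mult[OF test_fun_has_derivative[OF assms(1)]
    test_fun_has_derivative[OF assms(2)], of x]] by (metis (no_types, lifting))

text \<open>The product is again a test function, so its partial derivative integrates to 0; the
  product rule splits this integral.\<close>

lemma test_fun_integration_by_parts:
  assumes \<Omega>: "\<Omega> \<in> sets lebesgue" and f: "test_fun \<Omega> f" and g: "test_fun \<Omega> g" and i: "i \<in> Basis"
  shows "(LINT x|lebesgue_on \<Omega>. f x * frechet_derivative g (at x) i)
    = - (LINT x|lebesgue_on \<Omega>. frechet_derivative f (at x) i * g x)"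
proof -
  have fg: "test_fun \<Omega> (\<lambda>x. f x * g x)"
    using test_fun_mult[OF f] g by (simp add: test_fun_def)
  note p = test_fun_partial[OF fg i]
  have "0 = (LINT x|lebesgue_on \<Omega>. frechet_derivative (\<lambda>x. f x * g x) (at x) i)"
    using integral_test_fun_partial[OF fg i]
    by (subst lebesgue_on_eq_lborel(2)[OF \<Omega> test_fun_measurable[OF p] test_fun_zero_outside[OF p]]) auto
  also have "\<dots> = (LINT x|lebesgue_on \<Omega>. f x * frechet_derivative g (at x) i)
      + (LINT x|lebesgue_on \<Omega>. frechet_derivative f (at x) i * g x)"
    unfolding frechet_derivative_mult_test[OF f g]
    by (intro Bochner_Integration.integral_add L2_mult_integrable test_fun_L2 \<Omega> f g test_fun_partial i)
  finally show ?thesis by simp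
qed

section \<open>Scalar functions vanishing on the boundary\<close>

text \<open>The scalar analogue of \<open>H10\<close>; the weak gradient property is not part of the definition
  because it follows from the approximation by test functions.\<close>
definition h10 :: "'a::euclidean_space set \<Rightarrow> ('a \<Rightarrow> real) \<Rightarrow> ('a \<Rightarrow> 'a \<Rightarrow> real) \<Rightarrow> bool" where
  "h10 \<Omega> f g \<longleftrightarrow> L2 \<Omega> f \<and> (\<forall>i\<in>Basis. L2 \<Omega> (\<lambda>x. g x i)) \<and>
     (\<exists>\<psi>. (\<forall>m. test_fun \<Omega> (\<psi> m)) \<and>
        (\<lambda>m::nat. LINT x|lebesgue_on \<Omega>. (\<psi> m x - f x)\<^sup>2) \<longlonglongrightarrow> 0 \<and>
        (\<forall>i\<in>Basis. (\<lambda>m. LINT x|lebesgue_on \<Omega>. (frechet_derivative (\<psi> m) (at x) i - g x i)\<^sup>2) \<longlonglongrightarrow> 0))"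

lemma h10_L2: "h10 \<Omega> f g \<Longrightarrow> L2 \<Omega> f"
  and h10_grad_L2: "h10 \<Omega> f g \<Longrightarrow> i \<in> Basis \<Longrightarrow> L2 \<Omega> (\<lambda>x. g x i)"
  by (simp_all add: h10_def)

text \<open>Convergence in L^2 means that the squared differences converge in L^1, so a subsequence
  converges almost everywhere. Passing to it preserves the other limits.\<close>

lemma h10_approx_AE:
  assumes \<Omega>: "\<Omega> \<in> sets lebesgue" and h: "h10 \<Omega> f g"
  obtains \<psi> :: "nat \<Rightarrow> _" where "\<And>m. test_fun \<Omega> (\<psi> m)"
    "(\<lambda>m. LINT x|lebesgue_on \<Omega>. (\<psi> m x - f x)\<^sup>2) \<longlonglongrightarrow> 0"
    "\<And>i. i \<in> Basis \<Longrightarrow> (\<lambda>m. LINT x|lebesgue_on \<Omega>. (frechet_derivative (\<psi> m) (at x) i - g x i)\<^sup>2) \<longlonglongrightarrow> 0"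
    "AE x in lebesgue_on \<Omega>. (\<lambda>m. \<psi> m x) \<longlonglongrightarrow> f x"
proof -
  obtain \<psi> :: "nat \<Rightarrow> _" where \<psi>: "\<And>m. test_fun \<Omega> (\<psi> m)"
    "(\<lambda>m. LINT x|lebesgue_on \<Omega>. (\<psi> m x - f x)\<^sup>2) \<longlonglongrightarrow> 0"
    "\<And>i. i \<in> Basis \<Longrightarrow> (\<lambda>m. LINT x|lebesgue_on \<Omega>. (frechet_derivative (\<psi> m) (at x) i - g x i)\<^sup>2) \<longlonglongrightarrow> 0"
    using h unfolding h10_def by blast
  have "\<exists>r. strict_mono r \<and> (AE x in lebesgue_on \<Omega>. (\<lambda>n. (\<psi> (r n) x - f x)\<^sup>2) \<longlonglongrightarrow> 0)"
    by (rule tendsto_L1_AE_subseq)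
       (use \<psi>(2) L2_square_integrable[OF L2_diff[OF test_fun_L2[OF \<Omega> \<psi>(1)] h10_L2[OF h]]] in auto)
  then obtain r where r: "strict_mono r" "AE x in lebesgue_on \<Omega>. (\<lambda>n. (\<psi> (r n) x - f x)\<^sup>2) \<longlonglongrightarrow> 0"
    by blast
  have sq: "a \<longlonglongrightarrow> l" if "(\<lambda>n. (a n - l)\<^sup>2) \<longlonglongrightarrow> 0" for a :: "nat \<Rightarrow> real" and l
    using that by (simp add: LIM_zero_iff)
  have AE: "AE x in lebesgue_on \<Omega>. (\<lambda>n. \<psi> (r n) x) \<longlonglongrightarrow> f x"
    using r(2) by eventually_elim (rule sq)
  show ?thesis
    by (rule that[of "\<lambda>n. \<psi> (r n)"])
       (use \<psi> AE LIMSEQ_subseq_LIMSEQ[OF \<psi>(2) r(1)] LIMSEQ_subseq_LIMSEQ[OF \<psi>(3) r(1)] in \<open>auto simp: o_def\<close>)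
qed

text \<open>The weak derivative identity for \<open>w\<close> holds for the approximating test
  functions, and both sides pass to the limit. The boundary condition is carried by \<open>f\<close>
  alone.\<close>

lemma h10_integration_by_parts:
  assumes \<Omega>: "\<Omega> \<in> sets lebesgue" and h: "h10 \<Omega> f g" and i: "i \<in> Basis"
    and w: "L2 \<Omega> w" and w': "L2 \<Omega> w'"
    and weak: "\<And>\<phi>. test_fun \<Omega> \<phi> \<Longrightarrow> (LINT x|lebesgue_on \<Omega>. w x * frechet_derivative \<phi> (at x) i)
      = - (LINT x|lebesgue_on \<Omega>. w' x * \<phi> x)"
  shows "(LINT x|lebesgue_on \<Omega>. w x * g x i) = - (LINT x|lebesgue_on \<Omega>. w' x * f x)"
proof -
  let ?M = "lebesgue_on \<Omega>"
  obtain \<psi> :: "nat \<Rightarrow> _" where \<psi>: "\<And>m. test_fun \<Omega> (\<psi> m)"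
    "(\<lambda>m. LINT x|?M. (\<psi> m x - f x)\<^sup>2) \<longlonglongrightarrow> 0"
    "(\<lambda>m. LINT x|?M. (frechet_derivative (\<psi> m) (at x) i - g x i)\<^sup>2) \<longlonglongrightarrow> 0"
    using h i unfolding h10_def by blast
  have "(\<lambda>m. LINT x|?M. frechet_derivative (\<psi> m) (at x) i * w x) \<longlonglongrightarrow> (LINT x|?M. g x i * w x)"
    by (rule L2_limit_mult[OF test_fun_L2[OF \<Omega> test_fun_partial[OF \<psi>(1) i]] h10_grad_L2[OF h i] w \<psi>(3)])
  moreover have "(\<lambda>m. - (LINT x|?M. \<psi> m x * w' x)) \<longlonglongrightarrow> - (LINT x|?M. f x * w' x)"
    by (intro tendsto_minus L2_limit_mult[OF test_fun_L2[OF \<Omega> \<psi>(1)] h10_L2[OF h] w' \<psi>(2)])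
  moreover have "(LINT x|?M. frechet_derivative (\<psi> m) (at x) i * w x) = - (LINT x|?M. \<psi> m x * w' x)" for m
    using weak[OF \<psi>(1)] by (simp add: mult.commute)
  ultimately show ?thesis
    using LIMSEQ_unique by (simp add: mult.commute)
qed

text \<open>The chain rule in \<open>h10\<close>. Since \<open>G\<close> fixes 0, composing it with
  the approximating test functions gives test functions again. Their convergence follows from the
  Lipschitz bound, that of their gradients from continuity and boundedness of
  \<open>G'\<close>.\<close>

lemma h10_compose:
  fixes G G' :: "real \<Rightarrow> real"
  assumes \<Omega>: "\<Omega> \<in> sets lebesgue" and h: "h10 \<Omega> f g"
    and G: "smooth_fun G" "G 0 = 0" and G': "\<And>s. (G has_real_derivative G' s) (at s)"
    and B: "\<And>s. \<bar>G' s\<bar> \<le> B"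
  shows "h10 \<Omega> (\<lambda>x. G (f x)) (\<lambda>x i. G' (f x) * g x i)"
proof -
  let ?M = "lebesgue_on \<Omega>"
  have lip: "\<bar>G a - G b\<bar> \<le> B * \<bar>a - b\<bar>" for a b
    using field_differentiable_bound[of UNIV G G' B a b] G' B by (auto intro: has_field_derivative_at_within)
  \<comment> \<open>Identifying \<open>G'\<close> with the Frechet derivative transfers the
    smoothness of \<open>G\<close>, so that \<open>G'\<close> is continuous and hence
    measurable.\<close>
  have "G' s = frechet_derivative G (at s) 1" for s
    using frechet_derivative_at[OF has_field_derivative_imp_has_derivative[OF G'[of s]]]
    by (metis mult.right_neutral)
  then have contG': "continuous_on UNIV G'"
    using smooth_fun_continuous[OF smooth_fun_partial[OF G(1), of 1]] by simp
  have contG: "continuous_on UNIV G" by (rule smooth_fun_continuous[OF G(1)])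
  have [measurable]: "G \<in> borel_measurable borel" "G' \<in> borel_measurable borel"
    using contG contG' by (auto intro: borel_measurable_continuous_onI)
  have [measurable]: "f \<in> borel_measurable ?M" using L2_measurable[OF h10_L2[OF h]] .
  have B0: "B \<ge> 0" using B[of 0] by linarith
  have Gf: "L2 \<Omega> (\<lambda>x. G (f x))"
    by (rule L2_dominated[OF L2_cmult[OF h10_L2[OF h], of B]])
       (use lip[of _ 0] G(2) B0 in \<open>auto simp: abs_mult\<close>)
  have G'g: "L2 \<Omega> (\<lambda>x. G' (f x) * g x i)" if "i \<in> Basis" for i
    by (rule L2_bounded_mult[OF h10_grad_L2[OF h that] _ B]) simp
  obtain \<psi> :: "nat \<Rightarrow> _" where \<psi>: "\<And>m. test_fun \<Omega> (\<psi> m)"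
    "(\<lambda>m. LINT x|?M. (\<psi> m x - f x)\<^sup>2) \<longlonglongrightarrow> 0"
    "\<And>i. i \<in> Basis \<Longrightarrow> (\<lambda>m. LINT x|?M. (frechet_derivative (\<psi> m) (at x) i - g x i)\<^sup>2) \<longlonglongrightarrow> 0"
    "AE x in ?M. (\<lambda>m. \<psi> m x) \<longlonglongrightarrow> f x"
    using h10_approx_AE[OF \<Omega> h] by blast
  have [measurable]: "\<psi> m \<in> borel_measurable ?M" for m
    by (rule L2_measurable[OF test_fun_L2[OF \<Omega> \<psi>(1)]])
  have test: "test_fun \<Omega> (\<lambda>x. G (\<psi> m x))" for m
    by (rule test_fun_compose[OF \<psi>(1) G])
  have conv: "(\<lambda>m. LINT x|?M. (G (\<psi> m x) - G (f x))\<^sup>2) \<longlonglongrightarrow> 0"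
  proof (rule tendsto_sandwich[OF _ _ tendsto_const])
    show "(\<lambda>m. B\<^sup>2 * (LINT x|?M. (\<psi> m x - f x)\<^sup>2)) \<longlonglongrightarrow> 0"
      using tendsto_mult_right_zero[OF \<psi>(2)] .
    have "(G a - G b)\<^sup>2 \<le> B\<^sup>2 * (a - b)\<^sup>2" for a b
      using power_mono[OF lip, of a b 2] by (simp add: power_mult_distrib)
    then have "(LINT x|?M. (G (\<psi> m x) - G (f x))\<^sup>2) \<le> (LINT x|?M. B\<^sup>2 * (\<psi> m x - f x)\<^sup>2)" for m
      by (intro integral_mono L2_square_integrable L2_diff test_fun_L2 integrable_mult_right
          \<Omega> \<psi>(1) h10_L2[OF h] Gf test)
    then show "\<forall>\<^sub>F m in sequentially. (LINT x|?M. (G (\<psi> m x) - G (f x))\<^sup>2)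
        \<le> B\<^sup>2 * (LINT x|?M. (\<psi> m x - f x)\<^sup>2)"
      by simp
  qed auto
  have conv': "(\<lambda>m. LINT x|?M. (frechet_derivative (\<lambda>x. G (\<psi> m x)) (at x) i - G' (f x) * g x i)\<^sup>2) \<longlonglongrightarrow> 0"
    if i: "i \<in> Basis" for i
  proof -
    let ?p = "\<lambda>m x. frechet_derivative (\<psi> m) (at x) i"
    have chain: "frechet_derivative (\<lambda>x. G (\<psi> m x)) (at x) i = G' (\<psi> m x) * ?p m x" for m x
      using frechet_derivative_at[OF has_derivative_compose[OF test_fun_has_derivative[OF \<psi>(1)]
          has_field_derivative_imp_has_derivative[OF G']], of m x] by (metis (no_types, lifting))
    have p: "L2 \<Omega> (?p m)" for m by (rule test_fun_L2[OF \<Omega> test_fun_partial[OF \<psi>(1) i]])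
    have g: "L2 \<Omega> (\<lambda>x. g x i)" by (rule h10_grad_L2[OF h i])
    have L1: "L2 \<Omega> (\<lambda>x. G' (\<psi> m x) * (?p m x - g x i))" for m
      by (rule L2_bounded_mult[OF L2_diff[OF p g] _ B]) simp
    have L2': "L2 \<Omega> (\<lambda>x. (G' (\<psi> m x) - G' (f x)) * g x i)" for m
    proof (rule L2_bounded_mult[OF g])
      show "\<bar>G' (\<psi> m x) - G' (f x)\<bar> \<le> B + B" for x
        using B[of "\<psi> m x"] B[of "f x"] by linarith
    qed simp
    \<comment> \<open>Here almost everywhere convergence of the approximation enters:
      \<open>G'\<close> is continuous, and its bound gives the majorant.\<close>
    have lim2: "(\<lambda>m. LINT x|?M. ((G' (\<psi> m x) - G' (f x)) * g x i)\<^sup>2) \<longlonglongrightarrow> (LINT x|?M. 0)"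
    proof (rule integral_dominated_convergence[where w = "\<lambda>x. (2 * B)\<^sup>2 * (g x i)\<^sup>2"])
      show "(\<lambda>x. ((G' (\<psi> m x) - G' (f x)) * g x i)\<^sup>2) \<in> borel_measurable ?M" for m
        using L2_measurable[OF L2'] by simp
      show "integrable ?M (\<lambda>x. (2 * B)\<^sup>2 * (g x i)\<^sup>2)"
        using L2_square_integrable[OF g] by simp
      show "AE x in ?M. (\<lambda>m. ((G' (\<psi> m x) - G' (f x)) * g x i)\<^sup>2) \<longlonglongrightarrow> 0"
        using \<psi>(4)
      proof eventually_elim
        case (elim x)
        have "isCont G' (f x)" using contG' by (simp add: continuous_on_eq_continuous_at)
        from isCont_tendsto_compose[OF this elim]
        have "(\<lambda>m. ((G' (\<psi> m x) - G' (f x)) * g x i)\<^sup>2) \<longlonglongrightarrow> ((G' (f x) - G' (f x)) * g x i)\<^sup>2"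
          by (intro tendsto_intros)
        then show ?case by simp
      qed
      have "((G' a - G' b) * c)\<^sup>2 \<le> (2 * B)\<^sup>2 * c\<^sup>2" for a b c
        unfolding power_mult_distrib[of "_ - _"]
        by (intro mult_right_mono abs_le_square_iff[THEN iffD1]) (use B[of a] B[of b] in auto)
      then show "AE x in ?M. norm (((G' (\<psi> m x) - G' (f x)) * g x i)\<^sup>2) \<le> (2 * B)\<^sup>2 * (g x i)\<^sup>2" for m
        by simp
    qed simp
    show ?thesis
    proof (rule tendsto_sandwich[OF _ _ tendsto_const])
      show "(\<lambda>m. 2 * B\<^sup>2 * (LINT x|?M. (?p m x - g x i)\<^sup>2)
          + 2 * (LINT x|?M. ((G' (\<psi> m x) - G' (f x)) * g x i)\<^sup>2)) \<longlonglongrightarrow> 0"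
        using tendsto_add[OF tendsto_mult_right_zero[OF \<psi>(3)[OF i], of "2 * B\<^sup>2"]
            tendsto_mult_right_zero[of _ _ 2, OF lim2[simplified]]] by simp
      \<comment> \<open>The error is split into \<open>G'\<close> at the approximation times the
        gradient error, which is controlled by \<open>B\<close>, and the change of \<open>G'\<close>
        times the fixed gradient, which is controlled by \<open>lim2\<close>.\<close>
      have pw: "(G' a * p - G' b * c)\<^sup>2 \<le> 2 * B\<^sup>2 * (p - c)\<^sup>2 + 2 * ((G' a - G' b) * c)\<^sup>2" for a b c p
      proof -
        have "G' a * p - G' b * c = G' a * (p - c) + (G' a - G' b) * c" by (simp add: algebra_simps)
        then have "(G' a * p - G' b * c)\<^sup>2 \<le> 2 * (G' a * (p - c))\<^sup>2 + 2 * ((G' a - G' b) * c)\<^sup>2"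
          using sum_squares_bound[of "G' a * (p - c)" "(G' a - G' b) * c"]
          by (simp add: power2_sum)
        moreover have "(G' a)\<^sup>2 \<le> B\<^sup>2"
          by (intro abs_le_square_iff[THEN iffD1]) (use B[of a] in auto)
        ultimately show ?thesis
          using mult_right_mono[of "(G' a)\<^sup>2" "B\<^sup>2" "(p - c)\<^sup>2"] by (simp add: power_mult_distrib)
      qed
      have "(LINT x|?M. (G' (\<psi> m x) * ?p m x - G' (f x) * g x i)\<^sup>2)
        \<le> (LINT x|?M. 2 * B\<^sup>2 * (?p m x - g x i)\<^sup>2 + 2 * ((G' (\<psi> m x) - G' (f x)) * g x i)\<^sup>2)" for m
        by (intro integral_mono pw Bochner_Integration.integrable_add integrable_mult_right
            L2_square_integrable L2_diff p g L2' G'g i L2_bounded_mult[OF p _ B]) simp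
      also have "\<dots> m = 2 * B\<^sup>2 * (LINT x|?M. (?p m x - g x i)\<^sup>2)
          + 2 * (LINT x|?M. ((G' (\<psi> m x) - G' (f x)) * g x i)\<^sup>2)" for m
        using L2_square_integrable[OF L2_diff[OF p g]] L2_square_integrable[OF L2'] by simp
      finally show "\<forall>\<^sub>F m in sequentially.
          (LINT x|?M. (frechet_derivative (\<lambda>x. G (\<psi> m x)) (at x) i - G' (f x) * g x i)\<^sup>2)
          \<le> 2 * B\<^sup>2 * (LINT x|?M. (?p m x - g x i)\<^sup>2)
          + 2 * (LINT x|?M. ((G' (\<psi> m x) - G' (f x)) * g x i)\<^sup>2)"
        unfolding chain by simp
    qed auto
  qed
  show ?thesis
    unfolding h10_def using Gf G'g test conv conv'
    by (intro conjI ballI exI[where x = "\<lambda>m x. G (\<psi> m x)"] allI)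
qed

text \<open>The approximating test functions have bounded H^1 norms, so Ladyzhenskaya's inequality
  bounds their fourth powers uniformly. Fatou's lemma carries the bound over to
  \<open>f\<close>.\<close>

lemma h10_L4:
  fixes f :: "'a::euclidean_space \<Rightarrow> real"
  assumes dim: "DIM('a) = 2 \<or> DIM('a) = 3" and \<Omega>: "\<Omega> \<in> sets lebesgue" and h: "h10 \<Omega> f g"
  shows "L2 \<Omega> (\<lambda>x. (f x)\<^sup>2)"
proof -
  let ?M = "lebesgue_on \<Omega>"
  have [measurable]: "f \<in> borel_measurable ?M" using L2_measurable[OF h10_L2[OF h]] .
  obtain \<psi> :: "nat \<Rightarrow> _" where \<psi>: "\<And>m. test_fun \<Omega> (\<psi> m)"
    "(\<lambda>m. LINT x|?M. (\<psi> m x - f x)\<^sup>2) \<longlonglongrightarrow> 0"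
    "\<And>i. i \<in> Basis \<Longrightarrow> (\<lambda>m. LINT x|?M. (frechet_derivative (\<psi> m) (at x) i - g x i)\<^sup>2) \<longlonglongrightarrow> 0"
    "AE x in ?M. (\<lambda>m. \<psi> m x) \<longlonglongrightarrow> f x"
    using h10_approx_AE[OF \<Omega> h] by blast
  have [measurable]: "\<psi> m \<in> borel_measurable ?M" for m
    by (rule L2_measurable[OF test_fun_L2[OF \<Omega> \<psi>(1)]])
  have bd: "\<exists>C. \<forall>m. (LINT x|?M. (a m x)\<^sup>2) \<le> C"
    if a: "\<And>m. L2 \<Omega> (a m)" and b: "L2 \<Omega> b" and lim: "(\<lambda>m. LINT x|?M. (a m x - b x)\<^sup>2) \<longlonglongrightarrow> 0"
    for a :: "nat \<Rightarrow> 'a \<Rightarrow> real" and b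
  proof -
    obtain K where K: "\<And>m. \<bar>LINT x|?M. (a m x - b x)\<^sup>2\<bar> \<le> K"
      using convergent_imp_Bseq[OF convergentI[OF lim]] by (auto simp: Bseq_def)
    have "(LINT x|?M. (a m x)\<^sup>2) \<le> 2 * K + 2 * (LINT x|?M. (b x)\<^sup>2)" for m
    proof -
      have pw: "p\<^sup>2 \<le> 2 * (p - q)\<^sup>2 + 2 * q\<^sup>2" for p q :: real
        using sum_squares_bound[of "p - q" q] power2_sum[of "p - q" q] by simp
      have "(LINT x|?M. (a m x)\<^sup>2) \<le> (LINT x|?M. 2 * (a m x - b x)\<^sup>2 + 2 * (b x)\<^sup>2)"
        by (intro integral_mono pw Bochner_Integration.integrable_add integrable_mult_right
            L2_square_integrable L2_diff a b)
      also have "\<dots> = 2 * (LINT x|?M. (a m x - b x)\<^sup>2) + 2 * (LINT x|?M. (b x)\<^sup>2)"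
        using L2_square_integrable[OF L2_diff[OF a b]] L2_square_integrable[OF b] by simp
      finally show ?thesis using K[of m] by linarith
    qed
    then show ?thesis by blast
  qed
  have L: "(\<integral>\<^sup>+x. ennreal ((\<phi> x)\<^sup>2) \<partial>lborel) = ennreal (LINT x|?M. (\<phi> x)\<^sup>2)" if \<phi>: "test_fun \<Omega> \<phi>" for \<phi>
  proof -
    have [measurable]: "\<phi> \<in> borel_measurable borel" using test_fun_measurable[OF \<phi>] .
    note eq = lebesgue_on_eq_lborel[OF \<Omega>, of "\<lambda>x. (\<phi> x)\<^sup>2"]
    have "integrable lborel (\<lambda>x. (\<phi> x)\<^sup>2)"
      using eq(1) test_fun_zero_outside[OF \<phi>] L2_square_integrable[OF test_fun_L2[OF \<Omega> \<phi>]] by simp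
    then show ?thesis
      using eq(2) test_fun_zero_outside[OF \<phi>] by (subst nn_integral_eq_integral) auto
  qed
  obtain C0 where C0: "\<And>m. (LINT x|?M. (\<psi> m x)\<^sup>2) \<le> C0"
    using bd[OF test_fun_L2[OF \<Omega> \<psi>(1)] h10_L2[OF h] \<psi>(2)] by blast
  have "\<forall>i\<in>Basis. \<exists>C. \<forall>m. (LINT x|?M. (frechet_derivative (\<psi> m) (at x) i)\<^sup>2) \<le> C"
    using bd[OF test_fun_L2[OF \<Omega> test_fun_partial[OF \<psi>(1)]] h10_grad_L2[OF h] \<psi>(3)] by blast
  then obtain C where C: "\<And>i m. i \<in> Basis \<Longrightarrow> (LINT x|?M. (frechet_derivative (\<psi> m) (at x) i)\<^sup>2) \<le> C i"
    by metis
  define Q where "Q = ennreal C0 + (\<Sum>i\<in>(Basis::'a set). ennreal (C i))"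
  have "Q < \<infinity>" unfolding Q_def by (simp add: less_top)
  have bound: "(\<integral>\<^sup>+x. ennreal ((\<psi> m x)^4) \<partial>?M) \<le> 4 * Q\<^sup>2" for m
  proof -
    have "(\<integral>\<^sup>+x. ennreal ((\<psi> m x)^4) \<partial>?M) = (\<integral>\<^sup>+x. ennreal ((\<psi> m x)^4) * indicator \<Omega> x \<partial>lebesgue)"
      using \<Omega> by (subst nn_integral_restrict_space) auto
    also have "\<dots> \<le> (\<integral>\<^sup>+x. ennreal ((\<psi> m x)^4) \<partial>lebesgue)"
      by (intro nn_integral_mono) (auto simp: indicator_def)
    also have "\<dots> = (\<integral>\<^sup>+x. ennreal ((\<psi> m x)^4) \<partial>lborel)"
      by (simp add: nn_integral_completion)
    also note ladyzhenskaya[OF dim \<psi>(1)]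
    also have "(\<integral>\<^sup>+x. ennreal ((\<psi> m x)\<^sup>2) \<partial>lborel)
      + (\<Sum>i\<in>Basis. \<integral>\<^sup>+x. ennreal ((frechet_derivative (\<psi> m) (at x) i)\<^sup>2) \<partial>lborel) \<le> Q"
      unfolding Q_def L[OF \<psi>(1)] using C0 C
      by (intro add_mono sum_mono) (auto simp: L[OF test_fun_partial[OF \<psi>(1)]] intro: ennreal_leI)
    finally show ?thesis by (simp add: power_mono mult_left_mono)
  qed
  have "(\<integral>\<^sup>+x. ennreal ((f x)^4) \<partial>?M) = (\<integral>\<^sup>+x. liminf (\<lambda>m. ennreal ((\<psi> m x)^4)) \<partial>?M)"
  proof (rule nn_integral_cong_AE)
    show "AE x in ?M. ennreal ((f x)^4) = liminf (\<lambda>m. ennreal ((\<psi> m x)^4))"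
      using \<psi>(4)
    proof eventually_elim
      case (elim x)
      then have "(\<lambda>m. ennreal ((\<psi> m x)^4)) \<longlonglongrightarrow> ennreal ((f x)^4)"
        by (intro tendsto_ennrealI tendsto_power)
      then show ?case by (intro lim_imp_Liminf[symmetric]) simp_all
    qed
  qed
  also have "\<dots> \<le> liminf (\<lambda>m. \<integral>\<^sup>+x. ennreal ((\<psi> m x)^4) \<partial>?M)"
    by (rule nn_integral_liminf) simp
  also have "\<dots> \<le> 4 * Q\<^sup>2"
    using bound by (intro Liminf_le) auto
  also have "\<dots> < \<infinity>"
    using \<open>Q < \<infinity>\<close> by (simp add: ennreal_mult_less_top power_less_top_ennreal)
  finally have "integrable ?M (\<lambda>x. (f x)^4)"
    by (intro integrableI_nonneg) auto
  then show ?thesis unfolding L2_def by (simp flip: power_mult)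
qed

section \<open>Vector fields\<close>

lemma norm_square_components: "(norm (x::'a::euclidean_space))\<^sup>2 = (\<Sum>j\<in>Basis. (x \<bullet> j)\<^sup>2)"
  unfolding power2_norm_eq_inner by (subst euclidean_inner) (simp add: power2_eq_square)

lemma L2v_iff_components: "L2v \<Omega> u \<longleftrightarrow> (\<forall>j\<in>Basis. L2 \<Omega> (\<lambda>x. u x \<bullet> j))"
proof
  assume u: "L2v \<Omega> u"
  have m: "u \<in> borel_measurable (lebesgue_on \<Omega>)" using u by (simp add: L2v_def)
  have n: "L2 \<Omega> (\<lambda>x. norm (u x))" using u by (auto simp: L2_def L2v_def)
  show "\<forall>j\<in>Basis. L2 \<Omega> (\<lambda>x. u x \<bullet> j)"
    by (intro ballI L2_dominated[OF n]) (use m in \<open>auto simp: Basis_le_norm\<close>)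
next
  assume c: "\<forall>j\<in>Basis. L2 \<Omega> (\<lambda>x. u x \<bullet> j)"
  then have "u \<in> borel_measurable (lebesgue_on \<Omega>)"
    by (subst borel_measurable_euclidean_space) (simp add: L2_def)
  with c show "L2v \<Omega> u"
    unfolding L2v_def norm_square_components by (simp add: L2_def)
qed

lemma L2v_component: "L2v \<Omega> u \<Longrightarrow> j \<in> Basis \<Longrightarrow> L2 \<Omega> (\<lambda>x. u x \<bullet> j)"
  by (simp add: L2v_iff_components)

lemma L2v_norm_square_integral:
  assumes "L2v \<Omega> u"
  shows "(LINT x|lebesgue_on \<Omega>. (norm (u x))\<^sup>2) = (\<Sum>j\<in>Basis. LINT x|lebesgue_on \<Omega>. (u x \<bullet> j)\<^sup>2)"
  unfolding norm_square_components
  by (rule Bochner_Integration.integral_sum) (rule L2_square_integrable[OF L2v_component[OF assms]])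

lemma L2v_inner_integral:
  assumes "L2v \<Omega> u" "L2v \<Omega> v"
  shows "integrable (lebesgue_on \<Omega>) (\<lambda>x. u x \<bullet> v x)"
    and "(LINT x|lebesgue_on \<Omega>. u x \<bullet> v x) = (\<Sum>j\<in>Basis. LINT x|lebesgue_on \<Omega>. (u x \<bullet> j) * (v x \<bullet> j))"
  unfolding euclidean_inner[of "u _" "v _"]
  by (intro Bochner_Integration.integrable_sum Bochner_Integration.integral_sum
      L2_mult_integrable L2v_component assms; assumption)+

lemma L2v_lincomb:
  assumes "L2v \<Omega> u" "L2v \<Omega> v"
  shows "L2v \<Omega> (\<lambda>x. a *\<^sub>R u x - b *\<^sub>R v x)"
  unfolding L2v_iff_components inner_diff_left inner_scaleR_left
  by (intro ballI L2_diff L2_cmult L2v_component assms)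

lemma L2v_diff: "L2v \<Omega> u \<Longrightarrow> L2v \<Omega> v \<Longrightarrow> L2v \<Omega> (\<lambda>x. u x - v x)"
  using L2v_lincomb[of \<Omega> u v 1 1] by simp

text \<open>Approximation in \<open>H10\<close> is phrased with the derivative of the vector field,
  in \<open>h10\<close> with that of each component. The two agree because differentiability of all
  components gives that of the field.\<close>

lemma test_vfun_frechet_component:
  assumes "test_vfun \<Omega> \<phi>" "j \<in> Basis"
  shows "frechet_derivative \<phi> (at x) i \<bullet> j = frechet_derivative (\<lambda>x. \<phi> x \<bullet> j) (at x) i"
proof -
  have "\<phi> differentiable (at x)"
    using assms(1) unfolding test_vfun_def differentiable_componentwise_within[of \<phi>]
    by (blast intro: differentiableI test_fun_has_derivative)
  then have "(\<phi> has_derivative frechet_derivative \<phi> (at x)) (at x)"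
    by (simp add: frechet_derivative_works)
  from frechet_derivative_at[OF has_derivative_inner_left[OF this, of j]]
  show ?thesis by metis
qed

lemma test_vfun_L2v:
  assumes "\<Omega> \<in> sets lebesgue" "test_vfun \<Omega> \<phi>"
  shows "L2v \<Omega> \<phi>" and "i \<in> Basis \<Longrightarrow> L2v \<Omega> (\<lambda>x. frechet_derivative \<phi> (at x) i)"
proof -
  have t: "test_fun \<Omega> (\<lambda>x. \<phi> x \<bullet> j)" if "j \<in> Basis" for j
    using assms(2) that by (simp add: test_vfun_def)
  show "L2v \<Omega> \<phi>"
    unfolding L2v_iff_components using test_fun_L2[OF assms(1) t] by blast
  show "L2v \<Omega> (\<lambda>x. frechet_derivative \<phi> (at x) i)" if "i \<in> Basis"
    unfolding L2v_iff_components using test_fun_L2[OF assms(1) test_fun_partial[OF t that]]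
    by (simp add: test_vfun_frechet_component[OF assms(2)])
qed

lemma H10_imp_H1: "H10 \<Omega> u Du \<Longrightarrow> H1 \<Omega> u Du"
  by (simp add: H10_def)

lemma H1_L2v: "H1 \<Omega> u Du \<Longrightarrow> L2v \<Omega> u"
  and H1_grad_L2v: "H1 \<Omega> u Du \<Longrightarrow> i \<in> Basis \<Longrightarrow> L2v \<Omega> (\<lambda>x. Du x i)"
  by (simp_all add: H1_def)

lemma H10_component:
  assumes \<Omega>: "\<Omega> \<in> sets lebesgue" and u: "H10 \<Omega> u Du" and j: "j \<in> Basis"
  shows "h10 \<Omega> (\<lambda>x. u x \<bullet> j) (\<lambda>x i. Du x i \<bullet> j)"
proof -
  let ?M = "lebesgue_on \<Omega>"
  note H1 = H10_imp_H1[OF u]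
  obtain \<phi> :: "nat \<Rightarrow> 'a \<Rightarrow> 'a" where \<phi>: "\<And>m. test_vfun \<Omega> (\<phi> m)"
    "(\<lambda>m. LINT x|?M. (norm (\<phi> m x - u x))\<^sup>2) \<longlonglongrightarrow> 0"
    "(\<lambda>m. LINT x|?M. (\<Sum>i\<in>Basis. (norm (frechet_derivative (\<phi> m) (at x) i - Du x i))\<^sup>2)) \<longlonglongrightarrow> 0"
    using u unfolding H10_def by blast
  have d0: "L2v \<Omega> (\<lambda>x. \<phi> m x - u x)" for m
    by (intro L2v_diff test_vfun_L2v \<Omega> \<phi>(1) H1_L2v[OF H1])
  have d1: "L2v \<Omega> (\<lambda>x. frechet_derivative (\<phi> m) (at x) i - Du x i)" if "i \<in> Basis" for m i
    by (intro L2v_diff test_vfun_L2v \<Omega> \<phi>(1) H1_grad_L2v[OF H1] that)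
  have comp: "(y \<bullet> j)\<^sup>2 \<le> (norm y)\<^sup>2" for y
    using Basis_le_norm[OF j, of y] by (metis abs_ge_zero power2_abs power_mono)
  have "(\<lambda>m. LINT x|?M. (\<phi> m x \<bullet> j - u x \<bullet> j)\<^sup>2) \<longlonglongrightarrow> 0"
  proof (rule tendsto_sandwich[OF _ _ tendsto_const \<phi>(2)])
    have "(LINT x|?M. (\<phi> m x \<bullet> j - u x \<bullet> j)\<^sup>2) \<le> (LINT x|?M. (norm (\<phi> m x - u x))\<^sup>2)" for m
      unfolding inner_diff_left[symmetric]
    proof (rule integral_mono)
      show "integrable ?M (\<lambda>x. ((\<phi> m x - u x) \<bullet> j)\<^sup>2)"
        by (intro L2_square_integrable L2v_component d0 j)
      show "integrable ?M (\<lambda>x. (norm (\<phi> m x - u x))\<^sup>2)" using d0[of m] by (simp add: L2v_def)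
    qed (rule comp)
    then show "\<forall>\<^sub>F m in sequentially. (LINT x|?M. (\<phi> m x \<bullet> j - u x \<bullet> j)\<^sup>2)
        \<le> (LINT x|?M. (norm (\<phi> m x - u x))\<^sup>2)" by simp
  qed auto
  moreover have "(\<lambda>m. LINT x|?M. (frechet_derivative (\<lambda>x. \<phi> m x \<bullet> j) (at x) i - Du x i \<bullet> j)\<^sup>2) \<longlonglongrightarrow> 0"
    if i: "i \<in> Basis" for i
  proof (rule tendsto_sandwich[OF _ _ tendsto_const \<phi>(3)])
    have "(LINT x|?M. ((frechet_derivative (\<phi> m) (at x) i - Du x i) \<bullet> j)\<^sup>2)
        \<le> (LINT x|?M. (\<Sum>i\<in>Basis. (norm (frechet_derivative (\<phi> m) (at x) i - Du x i))\<^sup>2))" for m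
    proof (rule integral_mono)
      show "integrable ?M (\<lambda>x. ((frechet_derivative (\<phi> m) (at x) i - Du x i) \<bullet> j)\<^sup>2)"
        by (intro L2_square_integrable L2v_component d1 i j)
      show "integrable ?M (\<lambda>x. \<Sum>i\<in>Basis. (norm (frechet_derivative (\<phi> m) (at x) i - Du x i))\<^sup>2)"
        using d1 by (intro Bochner_Integration.integrable_sum) (simp add: L2v_def)
      show "((frechet_derivative (\<phi> m) (at x) i - Du x i) \<bullet> j)\<^sup>2
        \<le> (\<Sum>i\<in>Basis. (norm (frechet_derivative (\<phi> m) (at x) i - Du x i))\<^sup>2)" for x
        by (rule order_trans[OF comp member_le_sum[OF i]]) auto
    qed
    then show "\<forall>\<^sub>F m in sequentially.
        (LINT x|?M. (frechet_derivative (\<lambda>x. \<phi> m x \<bullet> j) (at x) i - Du x i \<bullet> j)\<^sup>2)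
        \<le> (LINT x|?M. (\<Sum>i\<in>Basis. (norm (frechet_derivative (\<phi> m) (at x) i - Du x i))\<^sup>2))"
      by (simp add: inner_diff_left test_vfun_frechet_component[OF \<phi>(1) j])
  qed auto
  moreover have "test_fun \<Omega> (\<lambda>x. \<phi> m x \<bullet> j)" for m
    using \<phi>(1)[of m] j by (simp add: test_vfun_def)
  moreover have "L2 \<Omega> (\<lambda>x. u x \<bullet> j)" "\<And>i. i \<in> Basis \<Longrightarrow> L2 \<Omega> (\<lambda>x. Du x i \<bullet> j)"
    by (intro L2v_component H1_L2v[OF H1] H1_grad_L2v[OF H1] j; assumption)+
  ultimately show ?thesis
    unfolding h10_def by (intro conjI ballI exI[where x = "\<lambda>m x. \<phi> m x \<bullet> j"] allI)
qed

text \<open>Integration by parts with the roles exchanged: the test function plays the part of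
  \<open>w\<close>, and its weak derivative identity is the classical one.\<close>

lemma h10_weak_grad:
  assumes \<Omega>: "\<Omega> \<in> sets lebesgue" and h: "h10 \<Omega> f g" and i: "i \<in> Basis" and \<phi>: "test_fun \<Omega> \<phi>"
  shows "(LINT x|lebesgue_on \<Omega>. f x * frechet_derivative \<phi> (at x) i)
    = - (LINT x|lebesgue_on \<Omega>. g x i * \<phi> x)"
  using h10_integration_by_parts[OF \<Omega> h i test_fun_L2[OF \<Omega> \<phi>] test_fun_L2[OF \<Omega> test_fun_partial[OF \<phi> i]]
      test_fun_integration_by_parts[OF \<Omega> \<phi> _ i]]
  by (simp add: mult.commute)

text \<open>The approximating sequences of the components are assembled into one vector-valued
  sequence, whose squared errors are finite sums of the component errors.\<close>

lemma H10_componentI: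
  assumes \<Omega>: "\<Omega> \<in> sets lebesgue"
    and h: "\<And>j. j \<in> Basis \<Longrightarrow> h10 \<Omega> (\<lambda>x. u x \<bullet> j) (\<lambda>x i. Du x i \<bullet> j)"
  shows "H10 \<Omega> u Du"
proof -
  let ?M = "lebesgue_on \<Omega>"
  have H1: "H1 \<Omega> u Du"
    unfolding H1_def weak_grad_def L2v_iff_components
    using h10_weak_grad[OF \<Omega> h] h10_L2[OF h] h10_grad_L2[OF h] by blast
  have "\<forall>j\<in>Basis. \<exists>\<psi>. (\<forall>m. test_fun \<Omega> (\<psi> m)) \<and>
        (\<lambda>m::nat. LINT x|?M. (\<psi> m x - u x \<bullet> j)\<^sup>2) \<longlonglongrightarrow> 0 \<and>
        (\<forall>i\<in>Basis. (\<lambda>m. LINT x|?M. (frechet_derivative (\<psi> m) (at x) i - Du x i \<bullet> j)\<^sup>2) \<longlonglongrightarrow> 0)"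
    using h unfolding h10_def by blast
  from bchoice[OF this] obtain \<psi> where "\<forall>j\<in>Basis. (\<forall>m. test_fun \<Omega> (\<psi> j m)) \<and>
        (\<lambda>m::nat. LINT x|?M. (\<psi> j m x - u x \<bullet> j)\<^sup>2) \<longlonglongrightarrow> 0 \<and>
        (\<forall>i\<in>Basis. (\<lambda>m. LINT x|?M. (frechet_derivative (\<psi> j m) (at x) i - Du x i \<bullet> j)\<^sup>2) \<longlonglongrightarrow> 0)"
    by (elim exE)
  then have \<psi>: "\<And>j m. j \<in> Basis \<Longrightarrow> test_fun \<Omega> (\<psi> j m)"
    "\<And>j. j \<in> Basis \<Longrightarrow> (\<lambda>m::nat. LINT x|?M. (\<psi> j m x - u x \<bullet> j)\<^sup>2) \<longlonglongrightarrow> 0"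
    "\<And>i j. j \<in> Basis \<Longrightarrow> i \<in> Basis \<Longrightarrow>
      (\<lambda>m. LINT x|?M. (frechet_derivative (\<psi> j m) (at x) i - Du x i \<bullet> j)\<^sup>2) \<longlonglongrightarrow> 0"
    by simp_all
  define \<phi> where "\<phi> m x = (\<Sum>j\<in>Basis. \<psi> j m x *\<^sub>R j)" for m x
  have \<phi>j: "\<phi> m x \<bullet> j = \<psi> j m x" if "j \<in> Basis" for m x j
    using that by (simp add: \<phi>_def)
  have test: "test_vfun \<Omega> (\<phi> m)" for m
    unfolding test_vfun_def using \<psi>(1) by (simp add: \<phi>j)
  have D: "frechet_derivative (\<phi> m) (at x) i \<bullet> j = frechet_derivative (\<psi> j m) (at x) i"
    if "j \<in> Basis" for m x i j
    using test_vfun_frechet_component[OF test that] by (simp add: \<phi>j[OF that])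
  have "(\<lambda>m. LINT x|?M. (norm (\<phi> m x - u x))\<^sup>2) \<longlonglongrightarrow> 0"
  proof -
    have "(LINT x|?M. (norm (\<phi> m x - u x))\<^sup>2) = (\<Sum>j\<in>Basis. LINT x|?M. (\<psi> j m x - u x \<bullet> j)\<^sup>2)" for m
      by (subst L2v_norm_square_integral)
         (simp_all add: L2v_diff test_vfun_L2v[OF \<Omega> test] H1_L2v[OF H1] inner_diff_left \<phi>j)
    then show ?thesis by (simp add: tendsto_null_sum \<psi>(2))
  qed
  moreover have "(\<lambda>m. LINT x|?M. (\<Sum>i\<in>Basis. (norm (frechet_derivative (\<phi> m) (at x) i - Du x i))\<^sup>2)) \<longlonglongrightarrow> 0"
  proof -
    have L: "L2v \<Omega> (\<lambda>x. frechet_derivative (\<phi> m) (at x) i - Du x i)" if "i \<in> Basis" for m i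
      by (intro L2v_diff test_vfun_L2v[OF \<Omega> test] H1_grad_L2v[OF H1] that)
    have "(LINT x|?M. (\<Sum>i\<in>Basis. (norm (frechet_derivative (\<phi> m) (at x) i - Du x i))\<^sup>2))
      = (\<Sum>i\<in>Basis. LINT x|?M. (norm (frechet_derivative (\<phi> m) (at x) i - Du x i))\<^sup>2)" for m
      by (rule Bochner_Integration.integral_sum) (use L in \<open>simp add: L2v_def\<close>)
    also have "\<dots> m = (\<Sum>i\<in>Basis. \<Sum>j\<in>Basis.
        LINT x|?M. (frechet_derivative (\<psi> j m) (at x) i - Du x i \<bullet> j)\<^sup>2)" for m
      by (intro sum.cong refl, subst L2v_norm_square_integral[OF L]) (simp_all add: inner_diff_left D)
    finally show ?thesis by (simp add: tendsto_null_sum \<psi>(3))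
  qed
  ultimately show ?thesis
    unfolding H10_def using H1 test by blast
qed

text \<open>This makes the truncated velocity an admissible test field in the momentum
  equation.\<close>

lemma H10_compose:
  fixes G G' :: "real \<Rightarrow> real"
  assumes \<Omega>: "\<Omega> \<in> sets lebesgue" and u: "H10 \<Omega> u Du"
    and G: "smooth_fun G" "G 0 = 0" "\<And>s. (G has_real_derivative G' s) (at s)" "\<And>s. \<bar>G' s\<bar> \<le> B"
  shows "H10 \<Omega> (\<lambda>x. \<Sum>j\<in>Basis. G (u x \<bullet> j) *\<^sub>R j)
    (\<lambda>x i. \<Sum>j\<in>Basis. (G' (u x \<bullet> j) * (Du x i \<bullet> j)) *\<^sub>R j)"
  by (rule H10_componentI[OF \<Omega>]) (simp add: h10_compose[OF \<Omega> H10_component[OF \<Omega> u] G])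

text \<open>The form with a difference matches the extrapolated velocity, whose coefficients are 1 +
  r and -r.\<close>

lemma H1_lincomb:
  fixes u v :: "'a::euclidean_space \<Rightarrow> 'a"
  assumes \<Omega>: "\<Omega> \<in> sets lebesgue" and u: "H1 \<Omega> u Du" and v: "H1 \<Omega> v Dv"
  shows "H1 \<Omega> (\<lambda>x. a *\<^sub>R u x - b *\<^sub>R v x) (\<lambda>x i. a *\<^sub>R Du x i - b *\<^sub>R Dv x i)"
  unfolding H1_def
proof (intro conjI ballI)
  let ?M = "lebesgue_on \<Omega>"
  show "L2v \<Omega> (\<lambda>x. a *\<^sub>R u x - b *\<^sub>R v x)"
    by (intro L2v_lincomb H1_L2v[OF u] H1_L2v[OF v])
  show "L2v \<Omega> (\<lambda>x. a *\<^sub>R Du x i - b *\<^sub>R Dv x i)" if "i \<in> Basis" for i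
    by (intro L2v_lincomb H1_grad_L2v[OF u] H1_grad_L2v[OF v] that)
  have lin: "(LINT x|?M. (a * f x - b * g x) * \<phi> x) = a * (LINT x|?M. f x * \<phi> x) - b * (LINT x|?M. g x * \<phi> x)"
    if "L2 \<Omega> f" "L2 \<Omega> g" "L2 \<Omega> \<phi>" for f g \<phi>
    using L2_mult_integrable[OF that(1,3)] L2_mult_integrable[OF that(2,3)]
    by (simp add: left_diff_distrib mult.assoc)
  show "weak_grad \<Omega> (\<lambda>x. a *\<^sub>R u x - b *\<^sub>R v x) (\<lambda>x i. a *\<^sub>R Du x i - b *\<^sub>R Dv x i)"
    unfolding weak_grad_def
  proof (intro ballI allI impI)
    fix i j :: 'a and \<phi> assume i: "i \<in> Basis" and j: "j \<in> Basis" and \<phi>: "test_fun \<Omega> \<phi>"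
    have "(LINT x|?M. (u x \<bullet> j) * frechet_derivative \<phi> (at x) i) = - (LINT x|?M. (Du x i \<bullet> j) * \<phi> x)"
      "(LINT x|?M. (v x \<bullet> j) * frechet_derivative \<phi> (at x) i) = - (LINT x|?M. (Dv x i \<bullet> j) * \<phi> x)"
      using u v i j \<phi> by (auto simp: H1_def weak_grad_def)
    moreover note lin[OF L2v_component[OF H1_L2v[OF u] j] L2v_component[OF H1_L2v[OF v] j]
        test_fun_L2[OF \<Omega> test_fun_partial[OF \<phi> i]]]
      lin[OF L2v_component[OF H1_grad_L2v[OF u i] j] L2v_component[OF H1_grad_L2v[OF v i] j] test_fun_L2[OF \<Omega> \<phi>]]
    ultimately show "(LINT x|?M. ((a *\<^sub>R u x - b *\<^sub>R v x) \<bullet> j) * frechet_derivative \<phi> (at x) i)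
      = - (LINT x|?M. ((a *\<^sub>R Du x i - b *\<^sub>R Dv x i) \<bullet> j) * \<phi> x)"
      by (simp add: inner_diff_left algebra_simps)
  qed
qed

lemma divg_L2: "H1 \<Omega> u Du \<Longrightarrow> L2 \<Omega> (divg Du)"
  unfolding divg_def[abs_def] by (intro L2_sum L2v_component H1_grad_L2v)

lemma grad_sq_integrable: "H1 \<Omega> u Du \<Longrightarrow> integrable (lebesgue_on \<Omega>) (grad_sq Du)"
  unfolding grad_sq_def[abs_def]
  by (intro Bochner_Integration.integrable_sum) (auto simp: H1_def L2v_def)

lemma grad_sq_integral:
  assumes "H1 \<Omega> u Du"
  shows "(LINT x|lebesgue_on \<Omega>. grad_sq Du x)
    = (\<Sum>i\<in>Basis. \<Sum>j\<in>Basis. LINT x|lebesgue_on \<Omega>. (Du x i \<bullet> j)\<^sup>2)"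
proof -
  have "(LINT x|lebesgue_on \<Omega>. grad_sq Du x) = (\<Sum>i\<in>Basis. LINT x|lebesgue_on \<Omega>. (norm (Du x i))\<^sup>2)"
    unfolding grad_sq_def
    by (rule Bochner_Integration.integral_sum) (use assms in \<open>auto simp: H1_def L2v_def\<close>)
  then show ?thesis
    by (simp add: L2v_norm_square_integral[OF H1_grad_L2v[OF assms]])
qed

text \<open>The bound by \<open>f\<close> gives (a n x - f x)^2 \<le> 4 (f x)^2, so dominated
  convergence applies.\<close>

lemma L2_dominated_limit:
  assumes f: "L2 \<Omega> f" and m: "\<And>n. a n \<in> borel_measurable (lebesgue_on \<Omega>)"
    and dom: "\<And>n x. \<bar>a n x\<bar> \<le> \<bar>f x\<bar>" and lim: "\<And>x. (\<lambda>n::nat. a n x) \<longlonglongrightarrow> f x"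
  shows "(\<lambda>n. LINT x|lebesgue_on \<Omega>. (a n x - f x)\<^sup>2) \<longlonglongrightarrow> 0"
proof -
  let ?M = "lebesgue_on \<Omega>"
  have fm[measurable]: "f \<in> borel_measurable ?M" by (rule L2_measurable[OF f])
  note m[measurable]
  have "(\<lambda>n. LINT x|?M. (a n x - f x)\<^sup>2) \<longlonglongrightarrow> (LINT x|?M. 0)"
  proof (rule integral_dominated_convergence[where w = "\<lambda>x. 4 * (f x)\<^sup>2"])
    show "integrable ?M (\<lambda>x. 4 * (f x)\<^sup>2)" using L2_square_integrable[OF f] by simp
    have "(\<lambda>n. (a n x - f x)\<^sup>2) \<longlonglongrightarrow> (f x - f x)\<^sup>2" for x
      by (intro tendsto_intros lim)
    then show "AE x in ?M. (\<lambda>n. (a n x - f x)\<^sup>2) \<longlonglongrightarrow> 0" by simp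
    have "(a n x - f x)\<^sup>2 \<le> (2 * f x)\<^sup>2" for n x
      using dom[of n x] by (intro abs_le_square_iff[THEN iffD1]) linarith
    then show "AE x in ?M. norm ((a n x - f x)\<^sup>2) \<le> 4 * (f x)\<^sup>2" for n
      by (simp add: power_mult_distrib)
  qed measurable
  then show ?thesis by simp
qed

section \<open>Testing the momentum equation\<close>

text \<open>The limit is the derivative of sin(c s) at s = 0 along s = 1/(n+1).\<close>

lemma sin_scaled_limit: "(\<lambda>n. sin (c / real (Suc n)) * real (Suc n)) \<longlonglongrightarrow> c"
proof -
  have "((\<lambda>s. sin (c * s)) has_real_derivative c) (at 0)"
    by (auto intro!: derivative_eq_intros)
  then have "((\<lambda>s. sin (c * s) / s) \<longlongrightarrow> c) (at 0)" by (simp add: DERIV_def)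
  moreover have "filterlim (\<lambda>n. 1 / real (Suc n)) (at 0) sequentially"
    unfolding filterlim_at using LIMSEQ_inverse_real_of_nat by (auto simp: inverse_eq_divide)
  ultimately have "(\<lambda>n. sin (c * (1 / real (Suc n))) / (1 / real (Suc n))) \<longlonglongrightarrow> c"
    by (rule filterlim_compose)
  then show ?thesis by simp
qed

text \<open>\<open>T\<^sub>\<delta>\<close>, its primitive \<open>S\<^sub>\<delta>\<close> and its derivative for \<open>\<delta> = 1/(n+1)\<close>.\<close>
definition sin_trunc :: "nat \<Rightarrow> real \<Rightarrow> real" where
  "sin_trunc n s = sin (s / real (Suc n)) * real (Suc n)"

definition sin_trunc_prim :: "nat \<Rightarrow> real \<Rightarrow> real" where
  "sin_trunc_prim n s = (1 - cos (s / real (Suc n))) * (real (Suc n))\<^sup>2"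

definition sin_trunc_deriv :: "nat \<Rightarrow> real \<Rightarrow> real" where
  "sin_trunc_deriv n s = cos (s / real (Suc n))"

lemma sin_trunc_zero: "sin_trunc n 0 = 0" and sin_trunc_prim_zero: "sin_trunc_prim n 0 = 0"
  by (simp_all add: sin_trunc_def sin_trunc_prim_def)

lemma sin_trunc_derivative: "(sin_trunc n has_real_derivative sin_trunc_deriv n s) (at s)"
  unfolding sin_trunc_def[abs_def] sin_trunc_deriv_def by (auto intro!: derivative_eq_intros)

lemma sin_trunc_prim_derivative: "(sin_trunc_prim n has_real_derivative sin_trunc n s) (at s)"
  unfolding sin_trunc_prim_def[abs_def] sin_trunc_def
  by (auto intro!: derivative_eq_intros simp: power2_eq_square simp del: of_nat_Suc)

lemma smooth_fun_sin_trunc_deriv: "smooth_fun (sin_trunc_deriv n)"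
  using smooth_fun_cos[of "1 / real (Suc n)"] by (simp add: sin_trunc_deriv_def[abs_def])

lemma smooth_fun_sin_trunc: "smooth_fun (sin_trunc n)"
  by (rule smooth_fun_DERIV[OF sin_trunc_derivative smooth_fun_sin_trunc_deriv])

lemma smooth_fun_sin_trunc_prim: "smooth_fun (sin_trunc_prim n)"
  by (rule smooth_fun_DERIV[OF sin_trunc_prim_derivative smooth_fun_sin_trunc])

lemma abs_sin_trunc_deriv_le: "\<bar>sin_trunc_deriv n s\<bar> \<le> 1"
  by (simp add: sin_trunc_deriv_def)

lemma abs_sin_trunc_bounded: "\<bar>sin_trunc n s\<bar> \<le> real (Suc n)"
  unfolding sin_trunc_def abs_mult using abs_sin_le_one[of "s / real (Suc n)"]
  by (simp add: mult_le_cancel_right1)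

lemma abs_sin_trunc_le: "\<bar>sin_trunc n s\<bar> \<le> \<bar>s\<bar>"
proof -
  have "\<bar>sin_trunc n s\<bar> \<le> \<bar>s / real (Suc n)\<bar> * real (Suc n)"
    unfolding sin_trunc_def abs_mult
    using mult_right_mono[OF abs_sin_x_le_abs_x, of "real (Suc n)" "s / real (Suc n)"] by simp
  then show ?thesis by simp
qed

text \<open>The half-angle formula 1 - cos(2x) = 2 sin(x)^2. It reduces the bound and the limit of
  the primitive to those of \<open>sin_trunc\<close>.\<close>

lemma sin_trunc_prim_eq: "sin_trunc_prim n s = 2 * (sin_trunc n (s / 2))\<^sup>2"
  using cos_double_sin[of "s / 2 / real (Suc n)"]
  by (simp add: sin_trunc_prim_def sin_trunc_def power_mult_distrib del: of_nat_Suc)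

lemma abs_sin_trunc_prim_le: "\<bar>sin_trunc_prim n s\<bar> \<le> \<bar>1 / 2 * s\<^sup>2\<bar>"
proof -
  have "(sin_trunc n (s / 2))\<^sup>2 \<le> (s / 2)\<^sup>2"
    using abs_sin_trunc_le by (simp add: abs_le_square_iff[symmetric] del: abs_divide)
  then show ?thesis unfolding sin_trunc_prim_eq by (simp add: power_divide)
qed

lemma sin_trunc_limit: "(\<lambda>n. sin_trunc n s) \<longlonglongrightarrow> s"
  unfolding sin_trunc_def by (rule sin_scaled_limit)

lemma sin_trunc_prim_limit: "(\<lambda>n. sin_trunc_prim n s) \<longlonglongrightarrow> 1 / 2 * s\<^sup>2"
proof -
  have "(\<lambda>n. 2 * (sin_trunc n (s / 2))\<^sup>2) \<longlonglongrightarrow> 2 * (s / 2)\<^sup>2"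
    by (intro tendsto_intros sin_trunc_limit)
  then show ?thesis by (simp add: sin_trunc_prim_eq power_divide)
qed

lemma sin_trunc_deriv_limit: "(\<lambda>n. sin_trunc_deriv n s) \<longlonglongrightarrow> 1"
proof -
  have "(\<lambda>n. s * (1 / real (Suc n))) \<longlonglongrightarrow> s * 0"
    using LIMSEQ_inverse_real_of_nat by (intro tendsto_intros) (simp add: inverse_eq_divide)
  then have "(\<lambda>n. cos (s / real (Suc n))) \<longlonglongrightarrow> cos 0"
    by (intro tendsto_cos) simp
  then show ?thesis by (simp add: sin_trunc_deriv_def)
qed

lemma smooth_fun_measurable: "smooth_fun f \<Longrightarrow> f \<in> borel_measurable borel"
  by (intro borel_measurable_continuous_onI smooth_fun_continuous)

section \<open>The convection term and the passage to the limit\<close>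

text \<open>By the chain rule \<open>T(u\<^sub>j) \<partial>\<^sub>i u\<^sub>j = \<partial>\<^sub>i
  S(u\<^sub>j)\<close>, where \<open>S(u\<^sub>j)\<close> vanishes on the boundary. Integrating by
  parts against the weak derivative of each component of \<open>w\<close> and summing over
  \<open>i\<close> produces the divergence.\<close>

lemma H10_convection_integral:
  fixes u :: "'a::euclidean_space \<Rightarrow> 'a" and n :: nat
  assumes \<Omega>: "\<Omega> \<in> sets lebesgue" and w: "H1 \<Omega> w Dw" and u: "H10 \<Omega> u Du"
  defines "v \<equiv> \<lambda>x. \<Sum>j\<in>Basis. sin_trunc n (u x \<bullet> j) *\<^sub>R j"
  shows "integrable (lebesgue_on \<Omega>) (\<lambda>x. convect w Du x \<bullet> v x)"
    and "(LINT x|lebesgue_on \<Omega>. convect w Du x \<bullet> v x)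
      = - (\<Sum>j\<in>Basis. LINT x|lebesgue_on \<Omega>. sin_trunc_prim n (u x \<bullet> j) * divg Dw x)"
proof -
  let ?M = "lebesgue_on \<Omega>"
  \<comment> \<open>The derivative of the primitive is \<open>sin_trunc n\<close>, bounded by n + 1
    for fixed \<open>n\<close>, as the chain rule requires.\<close>
  have h: "h10 \<Omega> (\<lambda>x. sin_trunc_prim n (u x \<bullet> j)) (\<lambda>x i. sin_trunc n (u x \<bullet> j) * (Du x i \<bullet> j))" if "j \<in> Basis" for j
    by (rule h10_compose[OF \<Omega> H10_component[OF \<Omega> u that] smooth_fun_sin_trunc_prim sin_trunc_prim_zero sin_trunc_prim_derivative abs_sin_trunc_bounded])
  have eq: "convect w Du x \<bullet> v x
      = (\<Sum>j\<in>Basis. \<Sum>i\<in>Basis. (w x \<bullet> i) * (sin_trunc n (u x \<bullet> j) * (Du x i \<bullet> j)))" for x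
    by (simp add: convect_def v_def inner_sum_left inner_sum_right sum_distrib_left mult_ac)
  have int: "integrable ?M (\<lambda>x. (w x \<bullet> i) * (sin_trunc n (u x \<bullet> j) * (Du x i \<bullet> j)))"
    if "i \<in> Basis" "j \<in> Basis" for i j
    by (intro L2_mult_integrable L2v_component[OF H1_L2v[OF w]] h10_grad_L2[OF h] that)
  show "integrable ?M (\<lambda>x. convect w Du x \<bullet> v x)"
    unfolding eq by (intro Bochner_Integration.integrable_sum int)
  have "(LINT x|?M. convect w Du x \<bullet> v x)
      = (\<Sum>j\<in>Basis. \<Sum>i\<in>Basis. LINT x|?M. (w x \<bullet> i) * (sin_trunc n (u x \<bullet> j) * (Du x i \<bullet> j)))"
    unfolding eq by (simp add: int)
  also have "\<dots> = (\<Sum>j\<in>Basis. \<Sum>i\<in>Basis. - (LINT x|?M. (Dw x i \<bullet> i) * sin_trunc_prim n (u x \<bullet> j)))"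
  proof (intro sum.cong refl)
    fix i j :: 'a assume i: "i \<in> Basis" and j: "j \<in> Basis"
    show "(LINT x|?M. (w x \<bullet> i) * (sin_trunc n (u x \<bullet> j) * (Du x i \<bullet> j)))
        = - (LINT x|?M. (Dw x i \<bullet> i) * sin_trunc_prim n (u x \<bullet> j))"
    proof (rule h10_integration_by_parts[OF \<Omega> h[OF j] i])
      show "L2 \<Omega> (\<lambda>x. w x \<bullet> i)" "L2 \<Omega> (\<lambda>x. Dw x i \<bullet> i)"
        by (intro L2v_component H1_L2v[OF w] H1_grad_L2v[OF w] i)+
    qed (use w i in \<open>simp add: H1_def weak_grad_def\<close>)
  qed
  also have "\<dots> = - (\<Sum>j\<in>Basis. \<Sum>i\<in>Basis. LINT x|?M. (Dw x i \<bullet> i) * sin_trunc_prim n (u x \<bullet> j))"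
    by (simp add: sum_negf)
  also have "\<dots> = - (\<Sum>j\<in>Basis. LINT x|?M. sin_trunc_prim n (u x \<bullet> j) * divg Dw x)"
  proof (intro arg_cong[where f = uminus] sum.cong refl)
    fix j :: 'a assume j: "j \<in> Basis"
    have "(LINT x|?M. sin_trunc_prim n (u x \<bullet> j) * divg Dw x)
        = (LINT x|?M. (\<Sum>i\<in>Basis. (Dw x i \<bullet> i) * sin_trunc_prim n (u x \<bullet> j)))"
      by (simp add: divg_def sum_distrib_left mult.commute)
    also have "\<dots> = (\<Sum>i\<in>Basis. LINT x|?M. (Dw x i \<bullet> i) * sin_trunc_prim n (u x \<bullet> j))"
      by (intro Bochner_Integration.integral_sum L2_mult_integrable L2v_component H1_grad_L2v[OF w]
          h10_L2[OF h] j)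
    finally show "(\<Sum>i\<in>Basis. LINT x|?M. (Dw x i \<bullet> i) * sin_trunc_prim n (u x \<bullet> j))
        = (LINT x|?M. sin_trunc_prim n (u x \<bullet> j) * divg Dw x)" ..
  qed
  finally show "(LINT x|?M. convect w Du x \<bullet> v x)
      = - (\<Sum>j\<in>Basis. LINT x|?M. sin_trunc_prim n (u x \<bullet> j) * divg Dw x)" .
qed

text \<open>Linearity isolates the truncation error \<open>e n\<close>, which lies in
  \<open>H10\<close>. The functional is bounded by the gradient norm, so convergence of the
  gradients suffices.\<close>

lemma Hm1_sin_trunc_limit:
  fixes u :: "'a::euclidean_space \<Rightarrow> 'a"
  assumes \<Omega>: "\<Omega> \<in> sets lebesgue" and F: "Hm1 \<Omega> F" and u: "H10 \<Omega> u Du"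
    and lim: "\<And>i j. i \<in> Basis \<Longrightarrow> j \<in> Basis \<Longrightarrow>
      (\<lambda>n. LINT x|lebesgue_on \<Omega>. (sin_trunc_deriv n (u x \<bullet> j) * (Du x i \<bullet> j) - Du x i \<bullet> j)\<^sup>2) \<longlonglongrightarrow> 0"
  shows "(\<lambda>n. F (\<lambda>x. \<Sum>j\<in>Basis. sin_trunc n (u x \<bullet> j) *\<^sub>R j)) \<longlonglongrightarrow> F u"
proof -
  let ?M = "lebesgue_on \<Omega>"
  define e where "e n x = (\<Sum>j\<in>Basis. (sin_trunc n (u x \<bullet> j) - u x \<bullet> j) *\<^sub>R j)" for n x
  define De where "De n x i = (\<Sum>j\<in>Basis. ((sin_trunc_deriv n (u x \<bullet> j) - 1) * (Du x i \<bullet> j)) *\<^sub>R j)" for n x i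
  obtain C where C: "\<And>v Dv. H10 \<Omega> v Dv \<Longrightarrow> \<bar>F v\<bar> \<le> C * grad_norm \<Omega> Dv"
    using F unfolding Hm1_def by blast
  have e: "H10 \<Omega> (e n) (De n)" for n
    unfolding e_def[abs_def] De_def[abs_def]
  proof (rule H10_compose[OF \<Omega> u, where B = 2])
    show "smooth_fun (\<lambda>s. sin_trunc n s - s)"
      using smooth_fun_add[OF smooth_fun_sin_trunc smooth_fun_mult[OF smooth_fun_const[of "-1"] smooth_fun_ident]]
      by simp
    show "((\<lambda>s. sin_trunc n s - s) has_real_derivative sin_trunc_deriv n s - 1) (at s)" for s
      by (intro derivative_intros sin_trunc_derivative)
    show "\<bar>sin_trunc_deriv n s - 1\<bar> \<le> 2" for s using abs_sin_trunc_deriv_le[of n s] by linarith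
  qed (simp add: sin_trunc_zero)
  have "F (\<lambda>x. \<Sum>j\<in>Basis. sin_trunc n (u x \<bullet> j) *\<^sub>R j) = F u + F (e n)" for n
  proof -
    \<comment> \<open>The factors 1 bring the sum into the shape of the linearity clause of
      \<open>Hm1\<close>.\<close>
    have "(\<lambda>x. \<Sum>j\<in>Basis. sin_trunc n (u x \<bullet> j) *\<^sub>R j) = (\<lambda>x. 1 *\<^sub>R u x + 1 *\<^sub>R e n x)"
      by (rule ext, rule euclidean_eqI) (simp add: e_def inner_add_left)
    moreover have "F (\<lambda>x. 1 *\<^sub>R u x + 1 *\<^sub>R e n x) = 1 * F u + 1 * F (e n)"
      using F u e[of n] unfolding Hm1_def by blast
    ultimately show ?thesis by simp
  qed
  moreover have "(\<lambda>n. F (e n)) \<longlonglongrightarrow> 0"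
  proof -
    have "(LINT x|?M. grad_sq (De n) x)
      = (\<Sum>i\<in>Basis. \<Sum>j\<in>Basis. LINT x|?M. (sin_trunc_deriv n (u x \<bullet> j) * (Du x i \<bullet> j) - Du x i \<bullet> j)\<^sup>2)" for n
      unfolding grad_sq_integral[OF H10_imp_H1[OF e]] De_def
      by (intro sum.cong refl) (simp add: left_diff_distrib)
    then have "(\<lambda>n. LINT x|?M. grad_sq (De n) x) \<longlonglongrightarrow> 0"
      by (simp add: tendsto_null_sum lim)
    then have "(\<lambda>n. C * sqrt (LINT x|?M. grad_sq (De n) x)) \<longlonglongrightarrow> C * sqrt 0"
      by (intro tendsto_intros)
    then have "(\<lambda>n. C * grad_norm \<Omega> (De n)) \<longlonglongrightarrow> 0" by (simp add: grad_norm_def)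
    then show ?thesis
      by (rule Lim_null_comparison[rotated]) (simp add: C[OF e])
  qed
  ultimately show ?thesis
    using tendsto_add[OF tendsto_const[of "F u"], of "\<lambda>n. F (e n)" 0] by simp
qed

text \<open>The equation is tested with the truncated velocity and the truncation is then removed.
  The convection term and the half-divergence term cancel only in the limit.\<close>

lemma momentum_energy:
  fixes u :: "'a::euclidean_space \<Rightarrow> 'a"
  assumes dim: "DIM('a) = 2 \<or> DIM('a) = 3" and \<Omega>: "\<Omega> \<in> sets lebesgue"
    and w: "H1 \<Omega> w Dw" and u: "H10 \<Omega> u Du" and a: "L2v \<Omega> a" and p: "L2 \<Omega> p" and F: "Hm1 \<Omega> F"
    and eq: "\<And>v Dv. H10 \<Omega> v Dv \<Longrightarrow>
      (LINT x|lebesgue_on \<Omega>. a x \<bullet> v x + convect w Du x \<bullet> v x + (1/2) * divg Dw x * (u x \<bullet> v x)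
        - p x * divg Dv x + \<nu> * grad_inner Du Dv x) = F v"
  shows "(LINT x|lebesgue_on \<Omega>. a x \<bullet> u x) - (LINT x|lebesgue_on \<Omega>. p x * divg Du x)
    + \<nu> * (LINT x|lebesgue_on \<Omega>. grad_sq Du x) = F u"
proof -
  let ?M = "lebesgue_on \<Omega>"
  define v where "v n x = (\<Sum>j\<in>Basis. sin_trunc n (u x \<bullet> j) *\<^sub>R j)" for n x
  define Dv where "Dv n x i = (\<Sum>j\<in>Basis. (sin_trunc_deriv n (u x \<bullet> j) * (Du x i \<bullet> j)) *\<^sub>R j)" for n x i
  define d where "d = divg Dw"
  have vj: "v n x \<bullet> j = sin_trunc n (u x \<bullet> j)" if "j \<in> Basis" for n x j
    using that by (simp add: v_def)
  have Dvj: "Dv n x i \<bullet> j = sin_trunc_deriv n (u x \<bullet> j) * (Du x i \<bullet> j)" if "j \<in> Basis" for n x i j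
    using that by (simp add: Dv_def)
  have v: "H10 \<Omega> (v n) (Dv n)" for n
    unfolding v_def[abs_def] Dv_def[abs_def]
    by (rule H10_compose[OF \<Omega> u smooth_fun_sin_trunc sin_trunc_zero sin_trunc_derivative abs_sin_trunc_deriv_le])
  note uH = H10_imp_H1[OF u] and vH = H10_imp_H1[OF v]
  have d: "L2 \<Omega> d" unfolding d_def by (rule divg_L2[OF w])
  \<comment> \<open>The squares of the components are in L^2 by the fourth-power estimate. This
    makes their products with the divergence of \<open>w\<close> integrable.\<close>
  have uj: "L2 \<Omega> (\<lambda>x. u x \<bullet> j)" and u2j: "L2 \<Omega> (\<lambda>x. (u x \<bullet> j)\<^sup>2)"
    and aj: "L2 \<Omega> (\<lambda>x. a x \<bullet> j)" if "j \<in> Basis" for j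
    using that h10_L4[OF dim \<Omega> H10_component[OF \<Omega> u]] L2v_component[OF a] L2v_component[OF H1_L2v[OF uH]]
    by auto
  have Duj: "L2 \<Omega> (\<lambda>x. Du x i \<bullet> j)" if "i \<in> Basis" "j \<in> Basis" for i j
    by (intro L2v_component H1_grad_L2v[OF uH] that)
  have um: "(\<lambda>x. u x \<bullet> j) \<in> borel_measurable ?M" if "j \<in> Basis" for j
    using L2_measurable[OF uj[OF that]] .
  have mT: "(\<lambda>x. sin_trunc n (u x \<bullet> j)) \<in> borel_measurable ?M"
    and mS: "(\<lambda>x. sin_trunc_prim n (u x \<bullet> j)) \<in> borel_measurable ?M"
    and mC: "(\<lambda>x. sin_trunc_deriv n (u x \<bullet> j)) \<in> borel_measurable ?M" if "j \<in> Basis" for n j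
    by (intro measurable_compose[OF um[OF that]] smooth_fun_measurable smooth_fun_sin_trunc smooth_fun_sin_trunc_prim
        smooth_fun_sin_trunc_deriv)+
  have T: "L2 \<Omega> (\<lambda>x. sin_trunc n (u x \<bullet> j))" if "j \<in> Basis" for n j
    by (rule L2_dominated[OF uj[OF that] mT[OF that] abs_sin_trunc_le])
  have uT_le: "\<bar>sin_trunc n s * s\<bar> \<le> \<bar>s\<^sup>2\<bar>" for n s
    using mult_right_mono[OF abs_sin_trunc_le[of n s], of "\<bar>s\<bar>"] by (simp add: abs_mult power2_eq_square)
  have uT: "L2 \<Omega> (\<lambda>x. sin_trunc n (u x \<bullet> j) * (u x \<bullet> j))" if "j \<in> Basis" for n j
    by (rule L2_dominated[OF u2j[OF that] borel_measurable_times[OF mT um] uT_le]) (rule that)+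
  have S: "L2 \<Omega> (\<lambda>x. sin_trunc_prim n (u x \<bullet> j))" if "j \<in> Basis" for n j
    by (rule L2_dominated[OF L2_cmult[OF u2j[OF that]] mS[OF that] abs_sin_trunc_prim_le])
  have CD_le: "\<bar>sin_trunc_deriv n s * t\<bar> \<le> \<bar>t\<bar>" for n s t
    using mult_right_mono[OF abs_sin_trunc_deriv_le[of n s], of "\<bar>t\<bar>"] by (simp add: abs_mult)
  have mCD: "(\<lambda>x. sin_trunc_deriv n (u x \<bullet> j) * (Du x i \<bullet> j)) \<in> borel_measurable ?M"
    if "i \<in> Basis" "j \<in> Basis" for n i j
    by (intro borel_measurable_times mC L2_measurable Duj that)
  have CD: "L2 \<Omega> (\<lambda>x. sin_trunc_deriv n (u x \<bullet> j) * (Du x i \<bullet> j))" if "i \<in> Basis" "j \<in> Basis" for n i j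
    by (rule L2_dominated[OF Duj[OF that] mCD[OF that] CD_le])

  have limT: "(\<lambda>n. LINT x|?M. (sin_trunc n (u x \<bullet> j) - u x \<bullet> j)\<^sup>2) \<longlonglongrightarrow> 0" if "j \<in> Basis" for j
    by (rule L2_dominated_limit[OF uj[OF that] mT[OF that] abs_sin_trunc_le sin_trunc_limit])
  have limuT: "(\<lambda>n. LINT x|?M. (sin_trunc n (u x \<bullet> j) * (u x \<bullet> j) - (u x \<bullet> j)\<^sup>2)\<^sup>2) \<longlonglongrightarrow> 0" if "j \<in> Basis" for j
  proof (rule L2_dominated_limit[OF u2j[OF that] borel_measurable_times[OF mT um] uT_le])
    show "(\<lambda>n. sin_trunc n (u x \<bullet> j) * (u x \<bullet> j)) \<longlonglongrightarrow> (u x \<bullet> j)\<^sup>2" for x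
      unfolding power2_eq_square by (intro tendsto_intros sin_trunc_limit)
  qed (rule that)+
  have limS: "(\<lambda>n. LINT x|?M. (sin_trunc_prim n (u x \<bullet> j) - 1/2 * (u x \<bullet> j)\<^sup>2)\<^sup>2) \<longlonglongrightarrow> 0" if "j \<in> Basis" for j
    by (rule L2_dominated_limit[OF L2_cmult[OF u2j[OF that]] mS[OF that] abs_sin_trunc_prim_le sin_trunc_prim_limit])
  have limC: "(\<lambda>n. LINT x|?M. (sin_trunc_deriv n (u x \<bullet> j) * (Du x i \<bullet> j) - Du x i \<bullet> j)\<^sup>2) \<longlonglongrightarrow> 0"
    if "i \<in> Basis" "j \<in> Basis" for i j
  proof (rule L2_dominated_limit[OF Duj[OF that] mCD[OF that] CD_le])
    show "(\<lambda>n. sin_trunc_deriv n (u x \<bullet> j) * (Du x i \<bullet> j)) \<longlonglongrightarrow> Du x i \<bullet> j" for x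
      using tendsto_mult[OF sin_trunc_deriv_limit tendsto_const] by fastforce
  qed

  \<comment> \<open>Each integrand is arranged as a truncated factor converging in L^2 times a fixed
    L^2 factor, the shape of \<open>L2_limit_mult\<close>.\<close>
  define I where "I n = (\<Sum>j\<in>Basis. LINT x|?M. sin_trunc n (u x \<bullet> j) * (a x \<bullet> j))
    - (\<Sum>j\<in>Basis. LINT x|?M. sin_trunc_prim n (u x \<bullet> j) * d x)
    + 1/2 * (\<Sum>j\<in>Basis. LINT x|?M. (sin_trunc n (u x \<bullet> j) * (u x \<bullet> j)) * d x)
    - (\<Sum>i\<in>Basis. LINT x|?M. (sin_trunc_deriv n (u x \<bullet> i) * (Du x i \<bullet> i)) * p x)
    + \<nu> * (\<Sum>i\<in>Basis. \<Sum>j\<in>Basis. LINT x|?M. (sin_trunc_deriv n (u x \<bullet> j) * (Du x i \<bullet> j)) * (Du x i \<bullet> j))" for n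
  have FI: "F (v n) = I n" for n
  proof -
    have 1: "integrable ?M (\<lambda>x. a x \<bullet> v n x)"
      "(LINT x|?M. a x \<bullet> v n x) = (\<Sum>j\<in>Basis. LINT x|?M. sin_trunc n (u x \<bullet> j) * (a x \<bullet> j))"
      using L2v_inner_integral[OF a H1_L2v[OF vH]] by (simp_all add: vj mult.commute)
    have 2: "integrable ?M (\<lambda>x. convect w Du x \<bullet> v n x)"
      "(LINT x|?M. convect w Du x \<bullet> v n x) = - (\<Sum>j\<in>Basis. LINT x|?M. sin_trunc_prim n (u x \<bullet> j) * d x)"
      using H10_convection_integral[OF \<Omega> w u, of n] by (simp_all add: v_def d_def)
    have e3: "(1/2) * divg Dw x * (u x \<bullet> v n x)
        = 1/2 * (\<Sum>j\<in>Basis. (sin_trunc n (u x \<bullet> j) * (u x \<bullet> j)) * d x)" for x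
      unfolding euclidean_inner[of "u x" "v n x"] d_def[symmetric]
      by (simp add: vj sum_distrib_left mult_ac)
    have i3: "integrable ?M (\<lambda>x. (sin_trunc n (u x \<bullet> j) * (u x \<bullet> j)) * d x)" if "j \<in> Basis" for j
      by (intro L2_mult_integrable uT d that)
    have 3: "integrable ?M (\<lambda>x. (1/2) * divg Dw x * (u x \<bullet> v n x))"
      "(LINT x|?M. (1/2) * divg Dw x * (u x \<bullet> v n x))
        = 1/2 * (\<Sum>j\<in>Basis. LINT x|?M. (sin_trunc n (u x \<bullet> j) * (u x \<bullet> j)) * d x)"
      unfolding e3 by (simp_all add: i3)
    have e4: "p x * divg (Dv n) x = (\<Sum>i\<in>Basis. (sin_trunc_deriv n (u x \<bullet> i) * (Du x i \<bullet> i)) * p x)" for x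
      by (simp add: divg_def Dvj sum_distrib_left mult_ac)
    have i4: "integrable ?M (\<lambda>x. (sin_trunc_deriv n (u x \<bullet> i) * (Du x i \<bullet> i)) * p x)" if "i \<in> Basis" for i
      by (intro L2_mult_integrable CD p that)
    have 4: "integrable ?M (\<lambda>x. p x * divg (Dv n) x)"
      "(LINT x|?M. p x * divg (Dv n) x) = (\<Sum>i\<in>Basis. LINT x|?M. (sin_trunc_deriv n (u x \<bullet> i) * (Du x i \<bullet> i)) * p x)"
      unfolding e4 by (simp_all add: i4)
    have e5: "grad_inner Du (Dv n) x
        = (\<Sum>i\<in>Basis. \<Sum>j\<in>Basis. (sin_trunc_deriv n (u x \<bullet> j) * (Du x i \<bullet> j)) * (Du x i \<bullet> j))" for x
      unfolding grad_inner_def euclidean_inner[of _ "Dv n x _"] by (simp add: Dvj mult_ac)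
    have i5: "integrable ?M (\<lambda>x. (sin_trunc_deriv n (u x \<bullet> j) * (Du x i \<bullet> j)) * (Du x i \<bullet> j))"
      if "i \<in> Basis" "j \<in> Basis" for i j
      by (intro L2_mult_integrable CD Duj that)
    have 5: "integrable ?M (\<lambda>x. \<nu> * grad_inner Du (Dv n) x)"
      "(LINT x|?M. \<nu> * grad_inner Du (Dv n) x)
        = \<nu> * (\<Sum>i\<in>Basis. \<Sum>j\<in>Basis. LINT x|?M. (sin_trunc_deriv n (u x \<bullet> j) * (Du x i \<bullet> j)) * (Du x i \<bullet> j))"
      unfolding e5 by (simp_all add: i5)
    have "F (v n) = (LINT x|?M. a x \<bullet> v n x) + (LINT x|?M. convect w Du x \<bullet> v n x)
      + (LINT x|?M. (1/2) * divg Dw x * (u x \<bullet> v n x)) - (LINT x|?M. p x * divg (Dv n) x)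
      + (LINT x|?M. \<nu> * grad_inner Du (Dv n) x)"
      unfolding eq[OF v, symmetric]
      using 1(1) 2(1) 3(1) 4(1) 5(1) by (simp del: integral_mult_right_zero integrable_mult_left_iff)
    then show ?thesis unfolding 1 2 3 4 5 I_def by simp
  qed
  have "I \<longlonglongrightarrow> (\<Sum>j\<in>Basis. LINT x|?M. (u x \<bullet> j) * (a x \<bullet> j))
    - (\<Sum>j\<in>Basis. LINT x|?M. (1/2 * (u x \<bullet> j)\<^sup>2) * d x)
    + 1/2 * (\<Sum>j\<in>Basis. LINT x|?M. (u x \<bullet> j)\<^sup>2 * d x)
    - (\<Sum>i\<in>Basis. LINT x|?M. (Du x i \<bullet> i) * p x)
    + \<nu> * (\<Sum>i\<in>Basis. \<Sum>j\<in>Basis. LINT x|?M. (Du x i \<bullet> j) * (Du x i \<bullet> j))"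
    unfolding I_def
    by (intro tendsto_add tendsto_diff tendsto_mult tendsto_const tendsto_sum
        L2_limit_mult T uj aj limT S L2_cmult u2j d limS uT limuT CD Duj p limC)
  \<comment> \<open>The primitive tends to s^2/2 while s times the truncation tends to s^2. Hence
    the convection limit is the negative of the half-divergence limit and the two drop out.\<close>
  also have "(\<Sum>j\<in>Basis. LINT x|?M. (1/2 * (u x \<bullet> j)\<^sup>2) * d x) = 1/2 * (\<Sum>j\<in>Basis. LINT x|?M. (u x \<bullet> j)\<^sup>2 * d x)"
    by (simp add: sum_distrib_left mult.assoc)
  also have "(\<Sum>j\<in>Basis. LINT x|?M. (u x \<bullet> j) * (a x \<bullet> j)) = (LINT x|?M. a x \<bullet> u x)"
    by (simp add: L2v_inner_integral[OF a H1_L2v[OF uH]] mult.commute)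
  also have "(\<Sum>i\<in>Basis. LINT x|?M. (Du x i \<bullet> i) * p x) = (LINT x|?M. p x * divg Du x)"
    unfolding divg_def sum_distrib_left
    by (subst Bochner_Integration.integral_sum) (auto simp: mult.commute intro!: L2_mult_integrable p Duj)
  also have "(\<Sum>i\<in>Basis. \<Sum>j\<in>Basis. LINT x|?M. (Du x i \<bullet> j) * (Du x i \<bullet> j)) = (LINT x|?M. grad_sq Du x)"
    by (simp add: grad_sq_integral[OF uH] power2_eq_square)
  finally have "I \<longlonglongrightarrow> (LINT x|?M. a x \<bullet> u x) - (LINT x|?M. p x * divg Du x) + \<nu> * (LINT x|?M. grad_sq Du x)"
    by simp
  moreover have "I \<longlonglongrightarrow> F u"
    using Hm1_sin_trunc_limit[OF \<Omega> F u limC] unfolding FI[symmetric] v_def .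
  ultimately show ?thesis by (rule LIMSEQ_unique)
qed

section \<open>The dual norm and algebraic identities\<close>

lemma Hm1_dual_norm_bound:
  assumes F: "Hm1 \<Omega> F" and u: "H10 \<Omega> u Du"
  shows "F u \<le> dual_norm \<Omega> F * grad_norm \<Omega> Du"
proof -
  obtain C where C: "\<And>v Dv. H10 \<Omega> v Dv \<Longrightarrow> \<bar>F v\<bar> \<le> C * grad_norm \<Omega> Dv"
    using F unfolding Hm1_def by blast
  have nn: "grad_norm \<Omega> Dv \<ge> 0" for Dv
    unfolding grad_norm_def grad_sq_def by (simp add: integral_nonneg_AE sum_nonneg)
  have "bdd_above {\<bar>F v\<bar> / grad_norm \<Omega> Dv | v Dv. H10 \<Omega> v Dv}"
  \<comment> \<open>The maximum with 0 covers fields with zero gradient norm, whose quotient is 0 by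
    convention.\<close>
  proof (rule bdd_aboveI[where M = "max C 0"])
    fix y assume "y \<in> {\<bar>F v\<bar> / grad_norm \<Omega> Dv | v Dv. H10 \<Omega> v Dv}"
    then obtain v Dv where y: "y = \<bar>F v\<bar> / grad_norm \<Omega> Dv" and v: "H10 \<Omega> v Dv" by blast
    show "y \<le> max C 0"
    proof (cases "grad_norm \<Omega> Dv = 0")
      case False
      then have "y \<le> C" using C[OF v] nn[of Dv] unfolding y by (simp add: divide_le_eq)
      then show ?thesis by simp
    qed (simp add: y)
  qed
  then have le: "\<bar>F u\<bar> / grad_norm \<Omega> Du \<le> dual_norm \<Omega> F"
    unfolding dual_norm_def using u by (intro cSup_upper) auto
  show ?thesis
  proof (cases "grad_norm \<Omega> Du = 0")
    \<comment> \<open>The quotient carries no information here, but the continuity bound of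
      \<open>F\<close> gives F u = 0.\<close>
    case True
    then show ?thesis using C[OF u] by simp
  next
    case False
    then have "\<bar>F u\<bar> \<le> dual_norm \<Omega> F * grad_norm \<Omega> Du"
      using le nn[of Du] by (simp add: divide_le_eq)
    then show ?thesis by linarith
  qed
qed

text \<open>Polarization of p p' with weight m = min e' e. The excess weights that remain are e' - m
  = (e' - e)^+ on p'^2 and e - m = (e - e')^+ on p^2.\<close>

lemma pressure_identity:
  fixes e e' p p' :: real
  shows "e' * p'\<^sup>2 - min e' e * (p * p') = 1/2 * (e' * p'\<^sup>2 - e * p\<^sup>2
    + (min e' e * (p' - p)\<^sup>2 + pos_part (e' - e) * p'\<^sup>2 + pos_part (e - e') * p\<^sup>2))"
  by (cases "e \<le> e'")
     (simp_all add: pos_part_def min_def max_def power2_eq_square algebra_simps)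

lemma velocity_identity:
  fixes u u' :: "'a::real_inner"
  shows "(u' - u) \<bullet> u' = 1/2 * ((norm u')\<^sup>2 - (norm u)\<^sup>2 + (norm (u' - u))\<^sup>2)"
  by (simp add: power2_norm_eq_inner inner_diff_left inner_diff_right inner_commute)

section \<open>Energy equality by telescoping and the stability bound\<close>

theorem theorem2p1:
  fixes \<Omega> :: "'a::euclidean_space set"
    and \<nu> :: real
    and k \<epsilon> :: "nat \<Rightarrow> real"
    and F :: "nat \<Rightarrow> ('a \<Rightarrow> 'a) \<Rightarrow> real"
    and u :: "nat \<Rightarrow> 'a \<Rightarrow> 'a" and Du :: "nat \<Rightarrow> 'a \<Rightarrow> 'a \<Rightarrow> 'a"
    and um1 :: "'a \<Rightarrow> 'a" and Dum1 :: "'a \<Rightarrow> 'a \<Rightarrow> 'a"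
    and p :: "nat \<Rightarrow> 'a \<Rightarrow> real"
    and N :: nat
  assumes dim: "DIM('a) = 2 \<or> DIM('a) = 3"
    and dom: "lipschitz_domain \<Omega>"
    and nu: "\<nu> > 0"
    and kpos: "\<forall>n. k n > 0"
    and epos: "\<forall>n. \<epsilon> n > 0"
    and forcing: "\<forall>n. Hm1 \<Omega> (F (Suc n))"
    and init_u: "H1 \<Omega> (u 0) (Du 0)" "H1 \<Omega> um1 Dum1"
    and init_p: "L2 \<Omega> (p 0)"
    and reg_u: "\<forall>n. H10 \<Omega> (u (Suc n)) (Du (Suc n))"
    and reg_p: "\<forall>n. L2 \<Omega> (p (Suc n))"
    and momentum: "\<forall>n. let r = k (Suc n) / k n;
                        us = (\<lambda>x. (1 + r) *\<^sub>R u n x - r *\<^sub>R prev um1 u n x);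
                        Dus = (\<lambda>x i. (1 + r) *\<^sub>R Du n x i - r *\<^sub>R prev Dum1 Du n x i)
                    in \<forall>v Dv. H10 \<Omega> v Dv \<longrightarrow>
                       (LINT x|lebesgue_on \<Omega>.
                           ((1 / k (Suc n)) *\<^sub>R (u (Suc n) x - u n x)) \<bullet> v x
                         + convect us (Du (Suc n)) x \<bullet> v x
                         + (1/2) * divg Dus x * (u (Suc n) x \<bullet> v x)
                         - p (Suc n) x * divg Dv x
                         + \<nu> * grad_inner (Du (Suc n)) Dv x)
                       = F (Suc n) v"
    and continuity: "\<forall>n q. L2 \<Omega> q \<longrightarrow>
                       (LINT x|lebesgue_on \<Omega>.
                          ((\<epsilon> (Suc n) * p (Suc n) x - min (\<epsilon> (Suc n)) (\<epsilon> n) * p n x) / k (Suc n)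
                           + divg (Du (Suc n)) x) * q x) = 0"
    and N: "N > 0"
  shows "(1/2) * (LINT x|lebesgue_on \<Omega>. (norm (u N x))\<^sup>2 + \<epsilon> N * (p N x)\<^sup>2)
         + (\<Sum>n<N. (1/2) * (LINT x|lebesgue_on \<Omega>.
              min (\<epsilon> (Suc n)) (\<epsilon> n) * (p (Suc n) x - p n x)\<^sup>2
              + pos_part (\<epsilon> (Suc n) - \<epsilon> n) * (p (Suc n) x)\<^sup>2
              + pos_part (\<epsilon> n - \<epsilon> (Suc n)) * (p n x)\<^sup>2))
         + (\<Sum>n<N. (LINT x|lebesgue_on \<Omega>.
              (1/2) * (norm (u (Suc n) x - u n x))\<^sup>2 + k (Suc n) * \<nu> * grad_sq (Du (Suc n)) x))
       = (1/2) * (LINT x|lebesgue_on \<Omega>. (norm (u 0 x))\<^sup>2 + \<epsilon> 0 * (p 0 x)\<^sup>2)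
         + (\<Sum>n<N. k (Suc n) * F (Suc n) (u (Suc n)))
     \<and> (1/2) * (LINT x|lebesgue_on \<Omega>. (norm (u N x))\<^sup>2 + \<epsilon> N * (p N x)\<^sup>2)
         + (\<Sum>n<N. (1/2) * (LINT x|lebesgue_on \<Omega>.
              min (\<epsilon> (Suc n)) (\<epsilon> n) * (p (Suc n) x - p n x)\<^sup>2
              + pos_part (\<epsilon> (Suc n) - \<epsilon> n) * (p (Suc n) x)\<^sup>2
              + pos_part (\<epsilon> n - \<epsilon> (Suc n)) * (p n x)\<^sup>2))
         + (\<Sum>n<N. (1/2) * (LINT x|lebesgue_on \<Omega>.
              (norm (u (Suc n) x - u n x))\<^sup>2 + k (Suc n) * \<nu> * grad_sq (Du (Suc n)) x))
       \<le> (1/2) * (LINT x|lebesgue_on \<Omega>. (norm (u 0 x))\<^sup>2 + \<epsilon> 0 * (p 0 x)\<^sup>2)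
         + (\<Sum>n<N. k (Suc n) * (1 / (2 * \<nu>)) * (dual_norm \<Omega> (F (Suc n)))\<^sup>2)"
proof -
  let ?M = "lebesgue_on \<Omega>"
  have \<Omega>: "\<Omega> \<in> sets lebesgue"
    using dom by (simp add: lipschitz_domain_def lmeasurable_open fmeasurableD)
  \<comment> \<open>The initial velocity is given only in H^1 and later ones lie in
    \<open>H10\<close>; membership in H^1 is what the extrapolated velocity needs.\<close>
  have uH1: "H1 \<Omega> (u n) (Du n)" for n
    using init_u(1) reg_u by (cases n) (auto intro: H10_imp_H1)
  have prevH1: "H1 \<Omega> (prev um1 u n) (prev Dum1 Du n)" for n
    using init_u(2) uH1 by (simp add: prev_def)
  have pL2: "L2 \<Omega> (p n)" for n
    using init_p reg_p by (cases n) auto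
  have uL2: "L2v \<Omega> (u n)" for n by (rule H1_L2v[OF uH1])
  have u2: "integrable ?M (\<lambda>x. (norm (u n x))\<^sup>2)" for n
    using uL2[of n] by (simp add: L2v_def)
  have du2: "integrable ?M (\<lambda>x. (norm (u (Suc n) x - u n x))\<^sup>2)" for n
    using L2v_diff[OF uL2 uL2, of "Suc n" n] by (simp add: L2v_def)
  have p2: "integrable ?M (\<lambda>x. (p n x)\<^sup>2)" for n
    by (rule L2_square_integrable[OF pL2])
  have dp2: "integrable ?M (\<lambda>x. (p (Suc n) x - p n x)\<^sup>2)" for n
    by (intro L2_square_integrable L2_diff pL2)
  have gI: "integrable ?M (\<lambda>x. grad_sq (Du n) x)" for n
    by (rule grad_sq_integrable[OF uH1])
  define E where "E n = (1/2) * (LINT x|?M. (norm (u n x))\<^sup>2 + \<epsilon> n * (p n x)\<^sup>2)" for n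
  define P where "P n = (1/2) * (LINT x|?M. min (\<epsilon> (Suc n)) (\<epsilon> n) * (p (Suc n) x - p n x)\<^sup>2
              + pos_part (\<epsilon> (Suc n) - \<epsilon> n) * (p (Suc n) x)\<^sup>2
              + pos_part (\<epsilon> n - \<epsilon> (Suc n)) * (p n x)\<^sup>2)" for n
  define V where "V n = (LINT x|?M. (norm (u (Suc n) x - u n x))\<^sup>2)" for n
  define G where "G n = (LINT x|?M. grad_sq (Du (Suc n)) x)" for n
  have G0: "G n \<ge> 0" for n
    unfolding G_def grad_sq_def by (simp add: integral_nonneg_AE sum_nonneg)
  \<comment> \<open>The one-step energy balance: the momentum equation tested with the new velocity,
    multiplied by the time step, with the pressure term replaced through the continuity
    equation.\<close>
  have step: "E (Suc n) + P n + (1/2 * V n + k (Suc n) * \<nu> * G n) = E n + k (Suc n) * F (Suc n) (u (Suc n))" for n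
  proof -
    have k: "k (Suc n) > 0" using kpos by blast
    let ?a = "\<lambda>x. (1 / k (Suc n)) *\<^sub>R (u (Suc n) x - u n x)"
    have mom: "(LINT x|?M. ?a x \<bullet> u (Suc n) x) - (LINT x|?M. p (Suc n) x * divg (Du (Suc n)) x)
        + \<nu> * G n = F (Suc n) (u (Suc n))"
      unfolding G_def
    proof (rule momentum_energy[OF dim \<Omega> H1_lincomb[OF \<Omega> uH1[of n] prevH1[of n],
            of "1 + k (Suc n) / k n" "k (Suc n) / k n"] reg_u[rule_format]])
      show "L2v \<Omega> ?a"
        using L2v_lincomb[OF uL2 uL2, of "1 / k (Suc n)" "Suc n" "1 / k (Suc n)" n]
        by (simp add: scaleR_diff_right)
      show "L2 \<Omega> (p (Suc n))" by (rule pL2)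
      show "Hm1 \<Omega> (F (Suc n))" using forcing by blast
    qed (use momentum[rule_format, of n] in \<open>simp add: Let_def\<close>)
    have "(LINT x|?M. ?a x \<bullet> u (Suc n) x) = 1 / k (Suc n) * (1/2 * ((LINT x|?M. (norm (u (Suc n) x))\<^sup>2)
        - (LINT x|?M. (norm (u n x))\<^sup>2) + V n))"
      unfolding inner_scaleR_left velocity_identity V_def using u2 du2 by simp
    then have kin: "k (Suc n) * (LINT x|?M. ?a x \<bullet> u (Suc n) x)
      = 1/2 * ((LINT x|?M. (norm (u (Suc n) x))\<^sup>2) - (LINT x|?M. (norm (u n x))\<^sup>2) + V n)"
      using k by simp
    \<comment> \<open>The continuity equation is tested with the new pressure, which reproduces the
      pressure-divergence integral of the momentum balance.\<close>
    have "((\<epsilon> (Suc n) * p (Suc n) x - min (\<epsilon> (Suc n)) (\<epsilon> n) * p n x) / k (Suc n)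
          + divg (Du (Suc n)) x) * p (Suc n) x
        = (\<epsilon> (Suc n) * (p (Suc n) x)\<^sup>2 - min (\<epsilon> (Suc n)) (\<epsilon> n) * (p n x * p (Suc n) x)) / k (Suc n)
          + p (Suc n) x * divg (Du (Suc n)) x" for x
      using k by (simp add: field_simps power2_eq_square)
    then have "0 = (LINT x|?M. (\<epsilon> (Suc n) * (p (Suc n) x)\<^sup>2 - min (\<epsilon> (Suc n)) (\<epsilon> n) * (p n x * p (Suc n) x)) / k (Suc n)
          + p (Suc n) x * divg (Du (Suc n)) x)"
      using continuity[rule_format, OF pL2, of n "Suc n"] by simp
    also have "\<dots> = (LINT x|?M. \<epsilon> (Suc n) * (p (Suc n) x)\<^sup>2 - min (\<epsilon> (Suc n)) (\<epsilon> n) * (p n x * p (Suc n) x)) / k (Suc n)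
          + (LINT x|?M. p (Suc n) x * divg (Du (Suc n)) x)"
      using p2 L2_mult_integrable[OF pL2 pL2, of n "Suc n"] L2_mult_integrable[OF pL2 divg_L2[OF uH1], of "Suc n" "Suc n"]
      by simp
    finally have "k (Suc n) * (LINT x|?M. p (Suc n) x * divg (Du (Suc n)) x)
        = - (LINT x|?M. \<epsilon> (Suc n) * (p (Suc n) x)\<^sup>2 - min (\<epsilon> (Suc n)) (\<epsilon> n) * (p n x * p (Suc n) x))"
      using k by (simp add: field_simps)
    also have "(LINT x|?M. \<epsilon> (Suc n) * (p (Suc n) x)\<^sup>2 - min (\<epsilon> (Suc n)) (\<epsilon> n) * (p n x * p (Suc n) x))
      = 1/2 * (\<epsilon> (Suc n) * (LINT x|?M. (p (Suc n) x)\<^sup>2) - \<epsilon> n * (LINT x|?M. (p n x)\<^sup>2)) + P n"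
      unfolding pressure_identity P_def using p2 dp2 by (simp add: distrib_left)
    finally have pres: "k (Suc n) * (LINT x|?M. p (Suc n) x * divg (Du (Suc n)) x)
      = - (1/2 * (\<epsilon> (Suc n) * (LINT x|?M. (p (Suc n) x)\<^sup>2) - \<epsilon> n * (LINT x|?M. (p n x)\<^sup>2)) + P n)" .
    have E: "E m = 1/2 * ((LINT x|?M. (norm (u m x))\<^sup>2) + \<epsilon> m * (LINT x|?M. (p m x)\<^sup>2))" for m
      unfolding E_def using u2 p2 by simp
    have "k (Suc n) * F (Suc n) (u (Suc n)) = k (Suc n) * (LINT x|?M. ?a x \<bullet> u (Suc n) x)
        - k (Suc n) * (LINT x|?M. p (Suc n) x * divg (Du (Suc n)) x) + k (Suc n) * \<nu> * G n"
      unfolding mom[symmetric] by (simp only: distrib_left right_diff_distrib mult.assoc)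
    then show ?thesis unfolding kin pres E by (simp add: algebra_simps)
  qed
  have eq: "E m + (\<Sum>n<m. P n) + (\<Sum>n<m. 1/2 * V n + k (Suc n) * \<nu> * G n)
      = E 0 + (\<Sum>n<m. k (Suc n) * F (Suc n) (u (Suc n)))" for m
  proof (induction m)
    case (Suc m)
    then show ?case using step[of m] by simp
  qed simp
  \<comment> \<open>Young's inequality with weight \<nu>, so that exactly half of the viscous
    dissipation absorbs the forcing.\<close>
  have force: "k (Suc n) * F (Suc n) (u (Suc n))
      \<le> k (Suc n) * (1 / (2 * \<nu>)) * (dual_norm \<Omega> (F (Suc n)))\<^sup>2 + 1/2 * (k (Suc n) * \<nu> * G n)" for n
  proof -
    let ?f = "dual_norm \<Omega> (F (Suc n))" and ?g = "grad_norm \<Omega> (Du (Suc n))"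
    have g: "?g\<^sup>2 = G n" using G0[of n] by (simp add: grad_norm_def G_def)
    have "F (Suc n) (u (Suc n)) \<le> ?f * ?g"
      using Hm1_dual_norm_bound[OF forcing[rule_format] reg_u[rule_format]] .
    also have "\<dots> \<le> (1 / (2 * \<nu>)) * ?f\<^sup>2 + 1/2 * (\<nu> * ?g\<^sup>2)"
    proof -
      have "0 \<le> (?f - \<nu> * ?g)\<^sup>2 / (2 * \<nu>)" using nu by simp
      also have "\<dots> = (1 / (2 * \<nu>)) * ?f\<^sup>2 + 1/2 * (\<nu> * ?g\<^sup>2) - ?f * ?g"
        using nu by (simp add: power2_eq_square field_simps)
      finally show ?thesis by simp
    qed
    finally have "k (Suc n) * F (Suc n) (u (Suc n)) \<le> k (Suc n) * ((1 / (2 * \<nu>)) * ?f\<^sup>2 + 1/2 * (\<nu> * G n))"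
      unfolding g using kpos by (intro mult_left_mono) (auto intro: less_imp_le)
    then show ?thesis by (simp add: algebra_simps)
  qed
  have VG1: "(LINT x|?M. (1/2) * (norm (u (Suc n) x - u n x))\<^sup>2 + k (Suc n) * \<nu> * grad_sq (Du (Suc n)) x)
      = 1/2 * V n + k (Suc n) * \<nu> * G n" for n
    unfolding V_def G_def using du2 gI by simp
  \<comment> \<open>In the stability bound the factor 1/2 multiplies the viscous term too. The
    missing half is the amount used in \<open>force\<close>.\<close>
  have VG2: "(1/2) * (LINT x|?M. (norm (u (Suc n) x - u n x))\<^sup>2 + k (Suc n) * \<nu> * grad_sq (Du (Suc n)) x)
      = (1/2 * V n + k (Suc n) * \<nu> * G n) - 1/2 * (k (Suc n) * \<nu> * G n)" for n
    unfolding V_def G_def using du2 gI by simp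
  have "(\<Sum>n<N. k (Suc n) * F (Suc n) (u (Suc n))) \<le>
      (\<Sum>n<N. k (Suc n) * (1 / (2 * \<nu>)) * (dual_norm \<Omega> (F (Suc n)))\<^sup>2) + (\<Sum>n<N. 1/2 * (k (Suc n) * \<nu> * G n))"
    unfolding sum.distrib[symmetric] by (intro sum_mono force)
  then show ?thesis
    unfolding E_def[symmetric] P_def[symmetric] VG1 VG2 sum_subtractf using eq[of N] by linarith
qed

end
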